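(* Let $0<r_1<r_2$, $\mathcal{X}=B(0,r_1)\subset\mathbb{R}^3$, $\mathcal{Y}=\mathbb{R}^3\setminus B(0,r_2)$, $\Gamma=\partial B(0,r_2)$, and $K(x,y)=1/|x-y|$. Let $X_0=\{x_1,\dots,x_n\}\subset\mathcal{X}$ be finite, $X_{\mathrm{rep}}=\{x'_1,\dots,x'_k\}\subset X_0$, and $U\in\mathbb{R}^{n\times k}$ with $i$-th row $u_i^T$; define $e_i(y)=K(x_i,y)-\sum_{j=1}^kU_{ij}K(x'_j,y)$ for $y\in\mathcal{Y}$. Let $Y_p\subset\Gamma$ be a finite nonempty set of distinct points and $c\ge0$ an integer such that for every polynomial $p$ in three variables of total degree at most $2c$, $\int_\Gamma p\,\mathrm{d}S=\frac{4\pi r_2^2}{|Y_p|}\sum_{y\in Y_p}p(y)$. Let $Y_0\subset\mathcal{Y}$ be any finite nonempty point set. Then for each $i$, $$\frac{\|e_i(Y_0)\|_2}{\sqrt{|Y_0|}}\le (c+1)\frac{\|e_i(Y_p)\|_2}{\sqrt{|Y_p|}}+(c+2)\frac{1+|X_{\mathrm{rep}}|\,\|u_i\|_\infty}{r_2-r_1}\left(\frac{r_1}{r_2}\right)^{c+1}.$$ In particular, if $\varepsilon>0$ and $\|e_i(Y_p)\|_2\le\varepsilon\sqrt{|Y_p|}$ for each $x_i\in X_0$ (i.e. the interpolative decomposition $K(X_0,Y_p)\approx UK(X_{\mathrm{rep}},Y_p)$ has precision $\varepsilon\sqrt{|Y_p|}$), then for each $i$ $$\frac{\|e_i(Y_0)\|_2}{\sqrt{|Y_0|}}\le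 (c+1)\varepsilon+(c+2)\frac{1+|X_{\mathrm{rep}}|\,\|u_i\|_\infty}{r_2-r_1}\left(\frac{r_1}{r_2}\right)^{c+1}.$$
   Context: $B(0,r)$ is the open ball of radius $r$ centered at the origin; $|S|$ is the cardinality of a finite set; $\mathrm{d}S$ is surface measure on $\Gamma$. For a finite set $Z$, $e_i(Z)=(e_i(z))_{z\in Z}$ is the vector of values of $e_i$ on $Z$; $\|u_i\|_\infty=\max_j|U_{ij}|$; $|X_{\mathrm{rep}}|=k$. $e_i(Y_0)$ is the $i$-th row of the error matrix $K(X_0,Y_0)-UK(X_{\mathrm{rep}},Y_0)$, where $K(A,B)$ is the matrix $(K(a,b))_{a\in A,b\in B}$. *)

theory Defs
  imports "HOL-Analysis.Analysis"
begin

definition poly3_deg_le :: "nat \<Rightarrow> (real^3 \<Rightarrow> real) \<Rightarrow> bool" where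
  "poly3_deg_le d p \<longleftrightarrow>
     (\<exists>a :: nat \<Rightarrow> nat \<Rightarrow> nat \<Rightarrow> real. \<forall>x.
        p x = (\<Sum>(i,j,l) \<in> {(i,j,l). i + j + l \<le> d}.
                 a i j l * (x$1)^i * (x$2)^j * (x$3)^l))"

definition sph :: "real \<Rightarrow> real \<Rightarrow> real \<Rightarrow> real^3" where
  "sph r \<theta> \<phi> = vector [r * sin \<theta> * cos \<phi>, r * sin \<theta> * sin \<phi>, r * cos \<theta>]"

text \<open>Surface integral over the sphere of radius r about 0 w.r.t. surface measure dS,
  via the standard parametrisation (surface element r^2 sin theta).\<close>
definition sphere_integral :: "real \<Rightarrow> (real^3 \<Rightarrow> real) \<Rightarrow> real" where
  "sphere_integral r f =
     integral (cbox (0,0) (pi, 2*pi))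
       (\<lambda>(\<theta>,\<phi>). f (sph r \<theta> \<phi>) * r\<^sup>2 * sin \<theta>)"

definition kernel :: "real^3 \<Rightarrow> real^3 \<Rightarrow> real" where
  "kernel x y = 1 / norm (x - y)"

definition err :: "(nat \<Rightarrow> real^3) \<Rightarrow> (nat \<Rightarrow> real^3) \<Rightarrow> nat \<Rightarrow> (nat \<Rightarrow> nat \<Rightarrow> real)
                    \<Rightarrow> nat \<Rightarrow> real^3 \<Rightarrow> real" where
  "err x xr k U i y = kernel (x i) y - (\<Sum>j<k. U i j * kernel (xr j) y)"

definition l2_on :: "(real^3 \<Rightarrow> real) \<Rightarrow> (real^3) set \<Rightarrow> real" where
  "l2_on f Z = sqrt (\<Sum>z\<in>Z. (f z)\<^sup>2)"

text \<open>Max norm of the i-th row of U (0 if k = 0).\<close>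
definition row_maxnorm :: "(nat \<Rightarrow> nat \<Rightarrow> real) \<Rightarrow> nat \<Rightarrow> nat \<Rightarrow> real" where
  "row_maxnorm U k i = Max (insert 0 ((\<lambda>j. \<bar>U i j\<bar>) ` {..<k}))"

end

theory Submission
  imports Defs
begin

text \<open>
  Expand $1/|x-y| = \sum_l |x|^l |y|^{-l-1} P_l(\hat x \cdot \hat y)$ in Legendre polynomials and
  cut $e_i$ at degree $c$. As $|P_l| \le 1$, the tail is at most
  $\frac{1 + k\|u_i\|_\infty}{r_2-r_1} (r_1/r_2)^{c+1}$ wherever $|y| \ge r_2$. On $\Gamma$ the
  truncated error is a polynomial of degree at most $c$, and by
  $\frac1{4\pi}\int_{S^2} P_l(\xi\cdot\eta) P_m(\xi\cdot\zeta)\,dS(\xi) =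
  \frac{\delta_{lm}}{2l+1} P_l(\eta\cdot\zeta)$
  its value at any $y$ with $|y| \ge r_2$ is its mean over $\Gamma$ against the kernel
  $\sum_{l\le c} (2l+1) (r_2/|y|)^{l+1} P_l(\hat\xi \cdot \hat y)$ in $\xi$, whose mean square
  is at most $(c+1)^2$. All these integrands have degree at most $2c$, so the means over $\Gamma$
  are means over $Y_p$, and the Cauchy-Schwarz inequality for finite sums gives the factor $c+1$.

  The integral formula follows from the rotation invariance of the surface integral. Half-turns
  exchange any two unit vectors, so averaging a polynomial in the height over circles of
  latitude around a second pole is a selfadjoint operator; it does not raise the degree, and is
  therefore diagonal in the Legendre basis.
\<close>

section \<open>Legendre polynomials\<close>

fun legendre :: "nat \<Rightarrow> real poly" where
  "legendre 0 = 1"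
| "legendre (Suc 0) = [:0, 1:]"
| "legendre (Suc (Suc n)) =
     smult (1 / (real n + 2))
       (smult (2 * real n + 3) ([:0, 1:] * legendre (Suc n)) - smult (real n + 1) (legendre n))"

lemma smult_legendre_Suc_Suc:
  "smult (real n + 2) (legendre (Suc (Suc n))) =
     smult (2 * real n + 3) ([:0, 1:] * legendre (Suc n)) - smult (real n + 1) (legendre n)"
  by simp

lemma poly_legendre_Suc_Suc:
  "(real n + 2) * poly (legendre (Suc (Suc n))) x =
     (2 * real n + 3) * x * poly (legendre (Suc n)) x - (real n + 1) * poly (legendre n) x"
  by simp

lemma poly_pderiv_legendre_Suc_Suc:
  "(real n + 2) * poly (pderiv (legendre (Suc (Suc n)))) x =
     (2 * real n + 3) * (poly (legendre (Suc n)) x + x * poly (pderiv (legendre (Suc n))) x)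
     - (real n + 1) * poly (pderiv (legendre n)) x"
  using arg_cong[OF smult_legendre_Suc_Suc[of n], of "\<lambda>p. poly (pderiv p) x"]
  by (simp add: pderiv_smult pderiv_diff pderiv_mult pderiv_pCons algebra_simps del: legendre.simps)

declare legendre.simps(3) [simp del]

lemma degree_legendre_le: "degree (legendre n) \<le> n"
proof (induction n rule: legendre.induct)
  case (3 n)
  have "degree ([:0, 1:] * legendre (Suc n)) \<le> Suc (Suc n)"
    using degree_mult_le[of "[:0, 1:]" "legendre (Suc n)"] 3(1) by simp
  then show ?case
    using 3 by (auto simp: legendre.simps(3) intro!: degree_diff_le order.trans[OF degree_smult_le])
qed auto

lemma coeff_legendre_pos: "coeff (legendre n) n > 0"
proof (induction n rule: legendre.induct)
  case (3 n)
  have "coeff (legendre n) (Suc (Suc n)) = 0"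
    using degree_legendre_le[of n] by (intro coeff_eq_0) simp
  then show ?case using 3 by (simp add: legendre.simps(3))
qed auto

lemma poly_legendre_1 [simp]: "poly (legendre n) 1 = 1"
  by (induction n rule: legendre.induct) (simp_all add: legendre.simps(3) field_simps)

lemma poly_legendre_minus_1: "poly (legendre n) (-1) = (-1) ^ n"
  by (induction n rule: legendre.induct) (simp_all add: legendre.simps(3) field_simps)

lemma
  fixes x :: real
  shows poly_pderiv_legendre_Suc:
      "poly (pderiv (legendre (Suc n))) x =
         x * poly (pderiv (legendre n)) x + (real n + 1) * poly (legendre n) x"
    and mult_poly_pderiv_legendre_Suc:
      "x * poly (pderiv (legendre (Suc n))) x =
         poly (pderiv (legendre n)) x + (real n + 1) * poly (legendre (Suc n)) x"
proof -
  let ?P = "\<lambda>k. poly (legendre k) x" and ?P' = "\<lambda>k. poly (pderiv (legendre k)) x"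
  have "?P' (Suc n) = x * ?P' n + (real n + 1) * ?P n \<and>
      x * ?P' (Suc n) = ?P' n + (real n + 1) * ?P (Suc n)"
  proof (induction n)
    case 0
    then show ?case by (simp add: pderiv_pCons)
  next
    case (Suc n)
    have "(real n + 2) * ?P' (Suc (Suc n)) =
        (real n + 2) * (x * ?P' (Suc n) + (real n + 2) * ?P (Suc n))"
      using Suc poly_pderiv_legendre_Suc_Suc[of n x] by algebra
    then have "?P' (Suc (Suc n)) = x * ?P' (Suc n) + (real n + 2) * ?P (Suc n)"
      by (rule mult_left_cancel[THEN iffD1, rotated]) linarith
    moreover from this have "x * ?P' (Suc (Suc n)) = ?P' (Suc n) + (real n + 2) * ?P (Suc (Suc n))"
      using Suc poly_legendre_Suc_Suc[of n x] by algebra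
    ultimately show ?case by (simp add: add_ac)
  qed
  then show "?P' (Suc n) = x * ?P' n + (real n + 1) * ?P n"
    and "x * ?P' (Suc n) = ?P' n + (real n + 1) * ?P (Suc n)" by auto
qed

lemma legendre_ode:
  "((\<lambda>x. (1 - x\<^sup>2) * poly (pderiv (legendre n)) x) has_real_derivative
     - (real n * (real n + 1) * poly (legendre n) x)) (at x)"
proof (cases n)
  case 0
  then show ?thesis by simp
next
  case (Suc k)
  let ?P = "\<lambda>k. poly (legendre k)" and ?P' = "\<lambda>k. poly (pderiv (legendre k))"
  have "(1 - x\<^sup>2) * ?P' n x = real n * (?P k x - x * ?P n x)" for x
    using poly_pderiv_legendre_Suc[of k x] mult_poly_pderiv_legendre_Suc[of x k]
    unfolding Suc of_nat_Suc power2_eq_square by algebra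
  moreover have "((\<lambda>x. real n * (?P k x - x * ?P n x)) has_real_derivative
      real n * (?P' k x - (?P n x + x * ?P' n x))) (at x)"
    by (auto intro!: derivative_eq_intros)
  moreover have "?P' k x - (?P n x + x * ?P' n x) = - ((real n + 1) * ?P n x)"
    using poly_pderiv_legendre_Suc[of k x] mult_poly_pderiv_legendre_Suc[of x k]
    unfolding Suc of_nat_Suc by algebra
  ultimately show ?thesis by (simp add: mult.assoc)
qed

lemma poly_span_of_degree_sequence:
  fixes b :: "nat \<Rightarrow> 'a::field poly"
  assumes b: "\<And>m. degree (b m) \<le> m" "\<And>m. coeff (b m) m \<noteq> 0" and "degree p \<le> n"
  shows "\<exists>a. p = (\<Sum>m\<le>n. smult (a m) (b m))"
  using assms(3)
proof (induction n arbitrary: p)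
  case 0
  then obtain \<beta> where \<beta>: "b 0 = [:\<beta>:]" using b(1)[of 0] degree_eq_zeroE by auto
  obtain \<pi> where "p = [:\<pi>:]" using 0 degree_eq_zeroE by auto
  with \<beta> b(2)[of 0] show ?case by (auto intro!: exI[of _ "\<lambda>_. \<pi> / \<beta>"])
next
  case (Suc n)
  define \<beta> where "\<beta> = coeff p (Suc n) / coeff (b (Suc n)) (Suc n)"
  have "degree (p - smult \<beta> (b (Suc n))) \<le> n"
  proof (intro degree_le allI impI)
    fix i assume "n < i"
    then consider "i = Suc n" | "degree p < i" "degree (b (Suc n)) < i"
      using Suc.prems b(1)[of "Suc n"] by linarith
    then show "coeff (p - smult \<beta> (b (Suc n))) i = 0"
      by cases (simp_all add: \<beta>_def b(2) coeff_eq_0)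
  qed
  then obtain a where "p - smult \<beta> (b (Suc n)) = (\<Sum>m\<le>n. smult (a m) (b m))"
    using Suc.IH by blast
  then have "p = (\<Sum>m\<le>n. smult (a m) (b m)) + smult \<beta> (b (Suc n))"
    by (simp add: algebra_simps)
  also have "\<dots> = (\<Sum>m\<le>Suc n. smult ((a(Suc n := \<beta>)) m) (b m))"
    by (auto intro!: sum.cong)
  finally show ?case by blast
qed

lemma legendre_span: "degree p \<le> n \<Longrightarrow> \<exists>a. p = (\<Sum>m\<le>n. smult (a m) (legendre m))"
  by (rule poly_span_of_degree_sequence)
    (auto simp: degree_legendre_le less_imp_neq[OF coeff_legendre_pos, symmetric])

subsection \<open>Orthogonality\<close>

lemma has_integral_DERIV:
  fixes F :: "real \<Rightarrow> real"
  assumes "a \<le> b" and "\<And>x. (F has_real_derivative F' x) (at x)"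
  shows "(F' has_integral F b - F a) {a..b}"
  by (rule fundamental_theorem_of_calculus[OF assms(1)])
    (use assms(2) in \<open>auto simp flip: has_real_derivative_iff_has_vector_derivative
      intro: has_field_derivative_at_within\<close>)

definition legendre_ip :: "(real \<Rightarrow> real) \<Rightarrow> (real \<Rightarrow> real) \<Rightarrow> real" where
  "legendre_ip f g = integral {-1..1} (\<lambda>t. f t * g t) / 2"

lemma legendre_ip_cong:
  assumes "\<And>t. t \<in> {-1..1} \<Longrightarrow> g t = g' t"
  shows "legendre_ip f g = legendre_ip f g'"
  unfolding legendre_ip_def using assms by (auto intro!: integral_cong)

lemma legendre_ip_poly_sum:
  fixes n :: nat
  shows "legendre_ip (poly p) (poly (\<Sum>m\<le>n. smult (a m) (q m))) =
    (\<Sum>m\<le>n. a m * legendre_ip (poly p) (poly (q m)))"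
proof -
  have "integral {-1..1} (\<lambda>t. \<Sum>m\<le>n. a m * (poly p t * poly (q m) t)) =
      (\<Sum>m\<le>n. integral {-1..1} (\<lambda>t. a m * (poly p t * poly (q m) t)))"
    by (intro integral_sum integrable_continuous_real continuous_intros) simp
  then show ?thesis
    by (simp add: legendre_ip_def poly_sum sum_distrib_left sum_divide_distrib mult.left_commute)
qed

lemma legendre_ip_legendre_neq:
  assumes "m \<noteq> n"
  shows "legendre_ip (poly (legendre m)) (poly (legendre n)) = 0"
proof -
  let ?P = "\<lambda>k. poly (legendre k)" and ?P' = "\<lambda>k. poly (pderiv (legendre k))"
  let ?ev = "\<lambda>k. real k * (real k + 1)"
  define W where "W x = (1 - x\<^sup>2) * ?P' n x * ?P m x - (1 - x\<^sup>2) * ?P' m x * ?P n x" for x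
  have "(W has_real_derivative (?ev m - ?ev n) * (?P m x * ?P n x)) (at x)" for x
    unfolding W_def
    by (rule derivative_eq_intros legendre_ode poly_DERIV refl)+ (simp add: algebra_simps)
  from has_integral_DERIV[OF _ this, of "-1" 1]
  have "integral {-1..1} (\<lambda>x. (?ev m - ?ev n) * (?P m x * ?P n x)) = 0"
    by (intro integral_unique) (simp add: W_def)
  then have "(?ev m - ?ev n) * integral {-1..1} (\<lambda>x. ?P m x * ?P n x) = 0"
    by simp
  moreover have "?ev m \<noteq> ?ev n"
  proof -
    have "?ev m - ?ev n = (real m - real n) * (real m + real n + 1)" by algebra
    moreover have "real m + real n + 1 \<noteq> 0" by linarith
    ultimately show ?thesis using assms by (metis mult_eq_0_iff of_nat_eq_iff right_minus_eq)
  qed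
  ultimately show ?thesis by (simp add: legendre_ip_def)
qed

lemma legendre_ip_legendre_low_degree:
  assumes "degree p < n"
  shows "legendre_ip (poly (legendre n)) (poly p) = 0"
proof -
  obtain a where "p = (\<Sum>m\<le>degree p. smult (a m) (legendre m))"
    using legendre_span[OF order_refl] by blast
  then have "legendre_ip (poly (legendre n)) (poly p) =
      (\<Sum>m\<le>degree p. a m * legendre_ip (poly (legendre n)) (poly (legendre m)))"
    by (metis legendre_ip_poly_sum)
  also have "\<dots> = 0"
    using assms by (intro sum.neutral) (auto simp: legendre_ip_legendre_neq)
  finally show ?thesis .
qed

lemma legendre_ip_legendre_self:
  "legendre_ip (poly (legendre n)) (poly (legendre n)) = 1 / (2 * real n + 1)"
proof (cases n)
  case 0
  then show ?thesis by (simp add: legendre_ip_def)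
next
  case (Suc k)
  let ?P = "\<lambda>k. poly (legendre k)" and ?P' = "\<lambda>k. poly (pderiv (legendre k))"
  have "((\<lambda>x. x * (?P n x)\<^sup>2) has_real_derivative
      (2 * real n + 1) * (?P n x * ?P n x) + 2 * (?P n x * ?P' k x)) (at x)" for x
  proof -
    have "((\<lambda>x. x * (?P n x)\<^sup>2) has_real_derivative (?P n x)\<^sup>2 + 2 * ?P n x * (x * ?P' n x)) (at x)"
      by (auto intro!: derivative_eq_intros)
    also have "x * ?P' n x = ?P' k x + real n * ?P n x"
      using mult_poly_pderiv_legendre_Suc[of x k] by (simp add: Suc add.commute)
    finally show ?thesis by (simp add: algebra_simps power2_eq_square)
  qed
  from has_integral_DERIV[OF _ this, of "-1" 1]
  have "((\<lambda>x. (2 * real n + 1) * (?P n x * ?P n x) + 2 * (?P n x * ?P' k x)) has_integral 2) {-1..1}"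
    by (simp add: poly_legendre_minus_1 flip: power_mult)
  then have "2 = integral {-1..1}
      (\<lambda>x. (2 * real n + 1) * (?P n x * ?P n x) + 2 * (?P n x * ?P' k x))"
    by (simp add: integral_unique)
  also have "\<dots> = 2 * ((2 * real n + 1) * legendre_ip (?P n) (?P n) + 2 * legendre_ip (?P n) (?P' k))"
    unfolding legendre_ip_def
    by (subst integral_add) (auto intro!: integrable_continuous_real continuous_intros)
  also have "legendre_ip (?P n) (?P' k) = 0"
    using degree_legendre_le[of k]
    by (intro legendre_ip_legendre_low_degree) (simp add: degree_pderiv Suc)
  finally show ?thesis by (simp add: field_simps)
qed

section \<open>Rotation invariance of the surface integral\<close>

unbundle cross3_syntax

lemma GDERIV_continuous_on: "(\<And>x. GDERIV f x :> g x) \<Longrightarrow> continuous_on S f"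
  unfolding gderiv_def by (meson continuous_at_imp_continuous_on has_derivative_continuous)

lemma GDERIV_vector_derivative_compose:
  assumes "GDERIV f (\<gamma> t) :> g" and "(\<gamma> has_vector_derivative v) (at t)"
  shows "((\<lambda>t. f (\<gamma> t)) has_real_derivative v \<bullet> g) (at t)"
  using has_derivative_compose[OF assms(2)[unfolded has_vector_derivative_def]
      assms(1)[unfolded gderiv_def]]
  by (simp add: has_field_derivative_def mult_commute_abs)

lemma has_vector_derivative_vector_3:
  fixes f g h :: "real \<Rightarrow> real"
  assumes "(f has_real_derivative f') (at t)" "(g has_real_derivative g') (at t)"
    "(h has_real_derivative h') (at t)"
  shows "((\<lambda>t. vector [f t, g t, h t] :: real^3) has_vector_derivative vector [f', g', h']) (at t)"
  unfolding has_vector_derivative_def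
  by (subst has_derivative_componentwise_within)
    (use assms in \<open>auto simp: Basis_vec_def inner_axis forall_3 has_field_derivative_def
      mult_commute_abs\<close>)

definition sph_theta :: "real \<Rightarrow> real \<Rightarrow> real^3" where
  "sph_theta \<theta> \<phi> = vector [cos \<theta> * cos \<phi>, cos \<theta> * sin \<phi>, - sin \<theta>]"

definition sph_phi :: "real \<Rightarrow> real^3" where
  "sph_phi \<phi> = vector [- sin \<phi>, cos \<phi>, 0]"

lemma has_vector_derivative_sph:
  "((\<lambda>\<theta>. sph 1 \<theta> \<phi>) has_vector_derivative sph_theta \<theta> \<phi>) (at \<theta>)"
  "((\<lambda>\<phi>. sph 1 \<theta> \<phi>) has_vector_derivative sin \<theta> *\<^sub>R sph_phi \<phi>) (at \<phi>)"
  "((\<lambda>\<phi>. sph_theta \<theta> \<phi>) has_vector_derivative cos \<theta> *\<^sub>R sph_phi \<phi>) (at \<phi>)"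
proof -
  have scaleR: "s *\<^sub>R sph_phi \<phi> = vector [s * - sin \<phi>, s * cos \<phi>, 0]" for s
    by (simp add: sph_phi_def vec_eq_iff forall_3)
  show "((\<lambda>\<theta>. sph 1 \<theta> \<phi>) has_vector_derivative sph_theta \<theta> \<phi>) (at \<theta>)"
    "((\<lambda>\<phi>. sph 1 \<theta> \<phi>) has_vector_derivative sin \<theta> *\<^sub>R sph_phi \<phi>) (at \<phi>)"
    "((\<lambda>\<phi>. sph_theta \<theta> \<phi>) has_vector_derivative cos \<theta> *\<^sub>R sph_phi \<phi>) (at \<phi>)"
    unfolding scaleR sph_def sph_theta_def
    by (auto intro!: has_vector_derivative_vector_3 derivative_eq_intros)
qed

lemma norm_sph_1: "norm (sph 1 \<theta> \<phi>) = 1"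
proof -
  have "(sin \<theta> * cos \<phi>)\<^sup>2 + (sin \<theta> * sin \<phi>)\<^sup>2 + (cos \<theta>)\<^sup>2 = 1"
    by (metis sin_cos_squared_add sin_cos_squared_add2 distrib_left mult_1_right power_mult_distrib)
  then show ?thesis
    by (simp add: sph_def norm_eq_1 inner_vec_def sum_3 power2_eq_square)
qed

lemma continuous_on_vector_3 [continuous_intros]:
  fixes f g h :: "'a::t2_space \<Rightarrow> real"
  assumes "continuous_on S f" "continuous_on S g" "continuous_on S h"
  shows "continuous_on S (\<lambda>x. vector [f x, g x, h x] :: real^3)"
  by (subst continuous_on_componentwise)
    (use assms in \<open>auto simp: Basis_vec_def inner_axis forall_3\<close>)

lemma continuous_on_sph [continuous_intros]:
  fixes t p :: "'a::t2_space \<Rightarrow> real"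
  assumes "continuous_on S t" "continuous_on S p"
  shows "continuous_on S (\<lambda>x. sph 1 (t x) (p x))" "continuous_on S (\<lambda>x. sph_theta (t x) (p x))"
    "continuous_on S (\<lambda>x. sph_phi (p x))"
  unfolding sph_def sph_theta_def sph_phi_def by (intro continuous_intros assms)+

lemma cross_sph:
  "a \<times> sph 1 \<theta> \<phi> = (a \<bullet> sph_phi \<phi>) *\<^sub>R sph_theta \<theta> \<phi> - (a \<bullet> sph_theta \<theta> \<phi>) *\<^sub>R sph_phi \<phi>"
proof -
  have "sph_phi \<phi> \<times> sph_theta \<theta> \<phi> = - sph 1 \<theta> \<phi>"
    by (simp add: vec_eq_iff forall_3 cross_components sph_def sph_theta_def sph_phi_def)
      (use sin_cos_squared_add[of \<phi>] in algebra)
  then show ?thesis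
    by (metis Lagrange cross_minus_right minus_diff_eq minus_minus)
qed

lemma integral_divergence_eq_0:
  fixes A B A' B' :: "real \<Rightarrow> real \<Rightarrow> real"
  assumes A: "\<And>\<theta> \<phi>. ((\<lambda>\<theta>. A \<theta> \<phi>) has_real_derivative A' \<theta> \<phi>) (at \<theta>)"
    and B: "\<And>\<theta> \<phi>. ((\<lambda>\<phi>. B \<theta> \<phi>) has_real_derivative B' \<theta> \<phi>) (at \<phi>)"
    and cont: "continuous_on (cbox (a,c) (b,d)) (\<lambda>(\<theta>,\<phi>). A' \<theta> \<phi>)"
      "continuous_on (cbox (a,c) (b,d)) (\<lambda>(\<theta>,\<phi>). B' \<theta> \<phi>)"
    and boundary: "\<And>\<phi>. A a \<phi> = A b \<phi>" "\<And>\<theta>. B \<theta> c = B \<theta> d"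
    and le: "a \<le> b" "c \<le> d"
  shows "integral (cbox (a,c) (b,d)) (\<lambda>(\<theta>,\<phi>). A' \<theta> \<phi> + B' \<theta> \<phi>) = 0"
proof -
  have inner: "integral (cbox a b) (\<lambda>\<theta>. A' \<theta> \<phi>) = 0" "integral (cbox c d) (\<lambda>\<phi>. B' \<theta> \<phi>) = 0" for \<theta> \<phi>
    using has_integral_DERIV[OF le(1) A] has_integral_DERIV[OF le(2) B] boundary
    by (simp_all add: integral_unique)
  have "integral (cbox (a,c) (b,d)) (\<lambda>(\<theta>,\<phi>). A' \<theta> \<phi>) = 0"
    using integral_prod_continuous[OF cont(1)] integral_swap_continuous[OF cont(1)]
    by (simp add: inner del: box_real)
  moreover have "integral (cbox (a,c) (b,d)) (\<lambda>(\<theta>,\<phi>). B' \<theta> \<phi>) = 0"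
    using integral_prod_continuous[OF cont(2)] by (simp add: inner del: box_real)
  ultimately show ?thesis
    using integral_add[OF integrable_continuous[OF cont(1)] integrable_continuous[OF cont(2)]]
    by (simp add: case_prod_unfold)
qed

text \<open>With $e_\theta$, $e_\phi$ the coordinate frame, $a \times \xi = (a \cdot e_\phi)\,e_\theta -
  (a \cdot e_\theta)\,e_\phi$, so that $\sin\theta$ times the derivative of $f$ along $a \times \xi$ is
  $\partial_\theta(\sin\theta\,(a \cdot e_\phi) f) - \partial_\phi((a \cdot e_\theta) f)$: a divergence
  without flux through the boundary of the parameter rectangle.\<close>

lemma sphere_integral_rotation_field_eq_0:
  fixes f :: "real^3 \<Rightarrow> real"
  assumes f: "\<And>x. GDERIV f x :> g x" and g: "continuous_on UNIV g"
  shows "sphere_integral 1 (\<lambda>x. (a \<times> x) \<bullet> g x) = 0"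
proof -
  define F where "F \<theta> \<phi> = f (sph 1 \<theta> \<phi>)" for \<theta> \<phi>
  define G where "G \<theta> \<phi> = g (sph 1 \<theta> \<phi>)" for \<theta> \<phi>
  define A' where "A' \<theta> \<phi> = cos \<theta> * (a \<bullet> sph_phi \<phi>) * F \<theta> \<phi>
      + sin \<theta> * (a \<bullet> sph_phi \<phi>) * (sph_theta \<theta> \<phi> \<bullet> G \<theta> \<phi>)"
    for \<theta> \<phi>
  define B' where "B' \<theta> \<phi> = - (cos \<theta> * (a \<bullet> sph_phi \<phi>) * F \<theta> \<phi>
      + (a \<bullet> sph_theta \<theta> \<phi>) * (sin \<theta> * (sph_phi \<phi> \<bullet> G \<theta> \<phi>)))"
    for \<theta> \<phi>
  note [continuous_intros] =
    continuous_on_compose2[OF GDERIV_continuous_on[OF f] _ subset_UNIV]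
    continuous_on_compose2[OF g _ subset_UNIV]
  note [derivative_intros] = GDERIV_vector_derivative_compose[OF f has_vector_derivative_sph(1)]
    GDERIV_vector_derivative_compose[OF f has_vector_derivative_sph(2)]
  have a_sph_theta:
    "((\<lambda>\<phi>. a \<bullet> sph_theta \<theta> \<phi>) has_real_derivative cos \<theta> * (a \<bullet> sph_phi \<phi>)) (at \<phi>)" for \<theta> \<phi>
    using bounded_linear.has_vector_derivative
      [OF bounded_linear_inner_right has_vector_derivative_sph(3)]
    by (simp add: has_real_derivative_iff_has_vector_derivative)
  have "integral (cbox (0,0) (pi, 2*pi)) (\<lambda>(\<theta>,\<phi>). A' \<theta> \<phi> + B' \<theta> \<phi>) = 0"
  proof (rule integral_divergence_eq_0)
    show "((\<lambda>\<theta>. sin \<theta> * (a \<bullet> sph_phi \<phi>) * F \<theta> \<phi>) has_real_derivative A' \<theta> \<phi>) (at \<theta>)" for \<theta> \<phi>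
      unfolding F_def G_def A'_def by (auto intro!: derivative_eq_intros)
    show "((\<lambda>\<phi>. - ((a \<bullet> sph_theta \<theta> \<phi>) * F \<theta> \<phi>)) has_real_derivative B' \<theta> \<phi>) (at \<phi>)" for \<theta> \<phi>
      unfolding F_def G_def B'_def by (auto intro!: derivative_eq_intros a_sph_theta)
  qed (auto simp: A'_def B'_def F_def G_def case_prod_unfold sph_def sph_theta_def
      intro!: continuous_intros)
  moreover have "A' \<theta> \<phi> + B' \<theta> \<phi> = (a \<times> sph 1 \<theta> \<phi>) \<bullet> G \<theta> \<phi> * 1\<^sup>2 * sin \<theta>" for \<theta> \<phi>
    by (simp add: A'_def B'_def cross_sph inner_diff_left algebra_simps)
  ultimately show ?thesis by (simp add: sphere_integral_def G_def)
qed

text \<open>Rodrigues' formula; $a$ is meant to be a unit vector.\<close>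

definition rotation :: "real^3 \<Rightarrow> real \<Rightarrow> real^3 \<Rightarrow> real^3" where
  "rotation a t x = cos t *\<^sub>R x + sin t *\<^sub>R (a \<times> x) + ((1 - cos t) * (a \<bullet> x)) *\<^sub>R a"

lemma rotation_0 [simp]: "rotation a 0 x = x"
  by (simp add: rotation_def)

lemma inner_rotation_left: "rotation a t x \<bullet> y = x \<bullet> rotation a (- t) y"
proof -
  have "(a \<times> x) \<bullet> y = - (x \<bullet> (a \<times> y))"
    by (metis cross_triple cross_skew inner_minus_left inner_commute)
  then show ?thesis
    by (simp add: rotation_def inner_add_left inner_add_right inner_diff_right inner_commute)
qed

lemma rotation_cross:
  "norm a = 1 \<Longrightarrow> rotation a t (a \<times> x) = a \<times> rotation a t x"
  by (simp add: rotation_def cross_add_right cross_mult_right dot_cross_self)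

lemma rotation_minus_rotation:
  assumes "norm a = 1"
  shows "rotation a (- t) (rotation a t x) = x"
proof -
  have "a \<bullet> rotation a t x = a \<bullet> x"
    using assms by (simp add: rotation_def inner_add_right dot_cross_self norm_eq_1 algebra_simps)
  then have "rotation a (- t) (rotation a t x) =
      cos t *\<^sub>R rotation a t x - sin t *\<^sub>R (a \<times> rotation a t x) + ((1 - cos t) * (a \<bullet> x)) *\<^sub>R a"
    by (simp add: rotation_def[of _ "- t"])
  also have "\<dots> = ((cos t)\<^sup>2 + (sin t)\<^sup>2) *\<^sub>R x + ((1 - ((cos t)\<^sup>2 + (sin t)\<^sup>2)) * (a \<bullet> x)) *\<^sub>R a"
    using assms unfolding rotation_def cross_add_right cross_mult_right Lagrange cross_refl
    by (simp add: norm_eq_1 algebra_simps power2_eq_square del: sin_cos_squared_add3)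
  finally show ?thesis by simp
qed

lemma inner_rotation:
  "norm a = 1 \<Longrightarrow> rotation a t x \<bullet> rotation a t y = x \<bullet> y"
  using rotation_minus_rotation[of a t y] by (simp add: inner_rotation_left)

lemma rotation_axis: "norm a = 1 \<Longrightarrow> rotation a t a = a"
  by (simp add: rotation_def norm_eq_1 algebra_simps)

lemma has_vector_derivative_rotation:
  assumes "norm a = 1"
  shows "((\<lambda>t. rotation a t x) has_vector_derivative a \<times> rotation a t x) (at t)"
proof -
  have "((\<lambda>t. rotation a t x) has_vector_derivative
      - sin t *\<^sub>R x + cos t *\<^sub>R (a \<times> x) + (sin t * (a \<bullet> x)) *\<^sub>R a) (at t)"
    unfolding rotation_def by (auto intro!: derivative_eq_intros)
  also have "- sin t *\<^sub>R x + cos t *\<^sub>R (a \<times> x) + (sin t * (a \<bullet> x)) *\<^sub>R a = a \<times> rotation a t x"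
    using assms unfolding rotation_def cross_add_right cross_mult_right Lagrange cross_refl
    by (simp add: norm_eq_1 algebra_simps)
  finally show ?thesis .
qed

lemma continuous_on_rotation [continuous_intros]:
  fixes f :: "'a::t2_space \<Rightarrow> real^3"
  assumes "continuous_on S t" "continuous_on S f"
  shows "continuous_on S (\<lambda>x. rotation a (t x) (f x))"
  unfolding rotation_def by (intro continuous_intros continuous_on_cross assms)

lemma GDERIV_rotation:
  assumes "GDERIV f (rotation a t x) :> g"
  shows "GDERIV (\<lambda>x. f (rotation a t x)) x :> rotation a (- t) g"
proof -
  have "linear (rotation a t)"
    by (rule linearI)
      (simp_all add: rotation_def cross_add_right cross_mult_right inner_add_right algebra_simps)
  then have "(rotation a t has_derivative rotation a t) (at x)"
    by (simp add: linear_imp_has_derivative)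
  from has_derivative_compose[OF this assms[unfolded gderiv_def]] show ?thesis
    by (simp add: gderiv_def inner_rotation_left)
qed

lemma sphere_integral_rotation:
  fixes f :: "real^3 \<Rightarrow> real"
  assumes a: "norm a = 1" and f: "\<And>x. GDERIV f x :> g x" and g: "continuous_on UNIV g"
  shows "sphere_integral 1 (\<lambda>x. f (rotation a t x)) = sphere_integral 1 f"
proof -
  define F where "F t = (\<lambda>(\<theta>,\<phi>). f (rotation a t (sph 1 \<theta> \<phi>)) * 1\<^sup>2 * sin \<theta>)" for t
  define F' where "F' t = (\<lambda>(\<theta>,\<phi>).
      (a \<times> rotation a t (sph 1 \<theta> \<phi>)) \<bullet> g (rotation a t (sph 1 \<theta> \<phi>)) * 1\<^sup>2 * sin \<theta>)" for t
  note [continuous_intros] =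
    continuous_on_compose2[OF GDERIV_continuous_on[OF f] _ subset_UNIV]
    continuous_on_compose2[OF g _ subset_UNIV]
  have F'_0: "integral (cbox (0,0) (pi, 2*pi)) (F' t) = 0" for t
  proof -
    have "sphere_integral 1 (\<lambda>x. (a \<times> x) \<bullet> rotation a (- t) (g (rotation a t x))) = 0"
      by (rule sphere_integral_rotation_field_eq_0[OF GDERIV_rotation[OF f]])
        (intro continuous_intros)
    then show ?thesis
      by (simp add: sphere_integral_def F'_def rotation_cross[OF a] flip: inner_rotation_left)
  qed
  have "((\<lambda>t. integral (cbox (0,0) (pi, 2*pi)) (F t)) has_real_derivative
      integral (cbox (0,0) (pi, 2*pi)) (F' t)) (at t within UNIV)" for t
  proof (rule leibniz_rule_field_derivative)
    show "((\<lambda>t. F t p) has_real_derivative F' t p) (at t within UNIV)" for t p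
      unfolding F_def F'_def case_prod_unfold
      by (auto intro!: derivative_eq_intros
          GDERIV_vector_derivative_compose[OF f has_vector_derivative_rotation[OF a]])
  qed (auto simp: F_def F'_def case_prod_unfold
      intro!: integrable_continuous continuous_intros continuous_on_cross)
  then have "integral (cbox (0,0) (pi, 2*pi)) (F t) = integral (cbox (0,0) (pi, 2*pi)) (F 0)"
    unfolding F'_0 using DERIV_isconst_all by blast
  then show ?thesis by (simp add: F_def sphere_integral_def)
qed

text \<open>The axis is the bisector of $\eta$ and $\zeta$, or any direction orthogonal to both if
  $\zeta = -\eta$.\<close>

lemma rotation_pi_swap:
  fixes \<eta> \<zeta> :: "real^3"
  assumes "norm \<eta> = 1" "norm \<zeta> = 1"
  obtains a where "norm a = 1" "rotation a pi \<eta> = \<zeta>" "rotation a pi \<zeta> = \<eta>"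
proof (cases "\<eta> + \<zeta> = 0")
  case True
  obtain y where y: "y \<noteq> 0" "orthogonal \<eta> y"
    using orthogonal_to_vector_exists[of \<eta>] by auto
  then have "sgn y \<bullet> \<eta> = 0" by (simp add: sgn_div_norm orthogonal_def inner_commute)
  moreover have "\<zeta> = - \<eta>" using True by (simp add: eq_neg_iff_add_eq_0 add.commute)
  ultimately show thesis
    using y by (intro that[of "sgn y"]) (auto simp: rotation_def norm_sgn)
next
  case False
  define s where "s = \<eta> + \<zeta>"
  have "s \<bullet> s = 2 * (s \<bullet> \<eta>)" "s \<bullet> s = 2 * (s \<bullet> \<zeta>)"
    using assms by (simp_all add: s_def inner_add_left inner_add_right inner_commute norm_eq_1)
  moreover have "s \<bullet> s \<noteq> 0" using False by (simp add: s_def)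
  ultimately have "2 * (s \<bullet> \<eta>) / (s \<bullet> s) = 1" "2 * (s \<bullet> \<zeta>) / (s \<bullet> s) = 1" by simp_all
  moreover have "rotation (sgn s) pi x = (2 * (s \<bullet> x) / (s \<bullet> s)) *\<^sub>R s - x" for x
    by (simp add: rotation_def sgn_div_norm dot_square_norm power2_eq_square divide_inverse)
  ultimately show thesis
    using False by (intro that[of "sgn s"]) (auto simp: s_def norm_sgn)
qed

unbundle no cross3_syntax

section \<open>Averages of zonal functions\<close>

definition zonal_pairing :: "(real \<Rightarrow> real) \<Rightarrow> (real \<Rightarrow> real) \<Rightarrow> real^3 \<Rightarrow> real^3 \<Rightarrow> real" where
  "zonal_pairing f g \<eta> \<zeta> = sphere_integral 1 (\<lambda>\<xi>. f (\<xi> \<bullet> \<eta>) * g (\<xi> \<bullet> \<zeta>)) / (4 * pi)"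

lemma zonal_pairing_commute: "zonal_pairing f g \<eta> \<zeta> = zonal_pairing g f \<zeta> \<eta>"
  by (simp add: zonal_pairing_def mult.commute)

lemma zonal_pairing_rotation:
  assumes "norm a = 1"
  shows "zonal_pairing (poly p) (poly q) (rotation a t \<eta>) (rotation a t \<zeta>) =
    zonal_pairing (poly p) (poly q) \<eta> \<zeta>"
proof -
  have inner: "GDERIV (\<lambda>\<xi>. \<xi> \<bullet> v) \<xi> :> v" for v \<xi> :: "real^3"
    by (simp add: gderiv_def bounded_linear_imp_has_derivative bounded_linear_inner_left)
  have deriv: "GDERIV (\<lambda>\<xi>. poly p (\<xi> \<bullet> \<eta>) * poly q (\<xi> \<bullet> \<zeta>)) \<xi> :>
      poly p (\<xi> \<bullet> \<eta>) *\<^sub>R poly (pderiv q) (\<xi> \<bullet> \<zeta>) *\<^sub>R \<zeta>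
        + poly q (\<xi> \<bullet> \<zeta>) *\<^sub>R poly (pderiv p) (\<xi> \<bullet> \<eta>) *\<^sub>R \<eta>" for \<xi>
    by (intro GDERIV_mult GDERIV_DERIV_compose inner poly_DERIV)
  have "sphere_integral 1 (\<lambda>\<xi>. poly p (rotation a (- t) \<xi> \<bullet> \<eta>) * poly q (rotation a (- t) \<xi> \<bullet> \<zeta>)) =
      sphere_integral 1 (\<lambda>\<xi>. poly p (\<xi> \<bullet> \<eta>) * poly q (\<xi> \<bullet> \<zeta>))"
    by (rule sphere_integral_rotation[OF assms deriv]) (intro continuous_intros)
  then show ?thesis
    unfolding zonal_pairing_def by (simp add: inner_rotation_left)
qed

lemma zonal_pairing_swap:
  assumes "norm \<eta> = 1" "norm \<zeta> = 1"
  shows "zonal_pairing (poly p) (poly q) \<eta> \<zeta> = zonal_pairing (poly q) (poly p) \<eta> \<zeta>"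
  using rotation_pi_swap[OF assms] zonal_pairing_rotation zonal_pairing_commute by metis

definition meridian :: "real \<Rightarrow> real^3" where
  "meridian s = vector [sqrt (1 - s\<^sup>2), 0, s]"

lemma norm_meridian: "\<bar>s\<bar> \<le> 1 \<Longrightarrow> norm (meridian s) = 1"
  by (simp add: meridian_def norm_eq_1 inner_vec_def sum_3 flip: abs_square_le_1 power2_eq_square)

lemma rotation_meridian:
  assumes "norm \<zeta> = 1"
  obtains t where "rotation (axis 3 1) t (meridian (\<zeta>$3)) = \<zeta>"
proof -
  define z where "z = Complex (\<zeta>$1) (\<zeta>$2)"
  have "(\<zeta>$1)\<^sup>2 + (\<zeta>$2)\<^sup>2 = 1 - (\<zeta>$3)\<^sup>2"
    using assms by (simp add: norm_eq_1 inner_vec_def sum_3 power2_eq_square)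
  then have "cmod z = sqrt (1 - (\<zeta>$3)\<^sup>2)" by (simp add: z_def cmod_def)
  moreover have "\<zeta>$1 = cmod z * cos (Arg z)" "\<zeta>$2 = cmod z * sin (Arg z)"
    using rcis_cmod_Arg[of z]
    by (metis Re_rcis complex.sel(1) z_def, metis Im_rcis complex.sel(2) z_def)
  ultimately have "rotation (axis 3 1) (Arg z) (meridian (\<zeta>$3)) = \<zeta>"
    by (simp add: rotation_def meridian_def vec_eq_iff forall_3 cross_components axis_def
        inner_vec_def sum_3 algebra_simps)
  then show thesis by (rule that)
qed

text \<open>With $t = \cos\theta$, the argument of $f$ is the inner product of the meridian point at
  height $s$ with the point of colatitude $\theta$ and azimuth $\phi$.\<close>

definition zonal_mean :: "(real \<Rightarrow> real) \<Rightarrow> real \<Rightarrow> real \<Rightarrow> real" where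
  "zonal_mean f s t =
     integral {0..2*pi} (\<lambda>\<phi>. f (s * t + sqrt (1 - s\<^sup>2) * sqrt (1 - t\<^sup>2) * cos \<phi>)) / (2 * pi)"

lemma continuous_on_zonal_mean:
  assumes "continuous_on UNIV f"
  shows "continuous_on S (zonal_mean f s)"
proof -
  note [continuous_intros] = continuous_on_compose2[OF assms _ subset_UNIV]
  have "continuous_on S (\<lambda>t. integral (cbox 0 (2*pi))
      (\<lambda>\<phi>. f (s * t + sqrt (1 - s\<^sup>2) * sqrt (1 - t\<^sup>2) * cos \<phi>)))"
    by (rule integral_continuous_on_param) (auto simp: case_prod_unfold intro!: continuous_intros)
  then show ?thesis
    unfolding zonal_mean_def by (auto intro!: continuous_intros)
qed

lemma legendre_ip_eq_integral_cos:
  assumes "continuous_on {-1..1} f" "continuous_on {-1..1} g"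
  shows "legendre_ip f g = integral {0..pi} (\<lambda>\<theta>. f (cos \<theta>) * g (cos \<theta>) * sin \<theta>) / 2"
proof -
  have "((\<lambda>\<theta>. (- sin \<theta>) *\<^sub>R (f (cos \<theta>) * g (cos \<theta>))) has_integral
      (integral {cos 0..cos pi} (\<lambda>s. f s * g s)
        - integral {cos pi..cos 0} (\<lambda>s. f s * g s))) {0..pi}"
    by (rule has_integral_substitution_general[where s = "{}" and c = "-1" and d = 1])
      (auto intro!: continuous_intros assms derivative_eq_intros
        simp flip: has_real_derivative_iff_has_vector_derivative)
  then have "((\<lambda>\<theta>. - (f (cos \<theta>) * g (cos \<theta>) * sin \<theta>)) has_integral
      - integral {-1..1} (\<lambda>s. f s * g s)) {0..pi}"
    by (simp add: mult_ac)
  then have "((\<lambda>\<theta>. f (cos \<theta>) * g (cos \<theta>) * sin \<theta>) has_integral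
      integral {-1..1} (\<lambda>s. f s * g s)) {0..pi}"
    by (simp add: has_integral_neg_iff)
  then show ?thesis by (simp add: legendre_ip_def integral_unique)
qed

lemma zonal_pairing_meridian:
  "zonal_pairing (poly p) (poly q) (axis 3 1) (meridian s) =
     legendre_ip (poly p) (zonal_mean (poly q) s)"
proof -
  define F where "F \<theta> \<phi> =
      poly p (cos \<theta>) * poly q (sin \<theta> * cos \<phi> * sqrt (1 - s\<^sup>2) + cos \<theta> * s) * sin \<theta>" for \<theta> \<phi>
  have "4 * pi * zonal_pairing (poly p) (poly q) (axis 3 1) (meridian s) =
      integral (cbox (0,0) (pi, 2*pi)) (\<lambda>(\<theta>,\<phi>). F \<theta> \<phi>)"
    by (simp add: zonal_pairing_def sphere_integral_def F_def sph_def meridian_def axis_def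
        inner_vec_def sum_3)
  also have "\<dots> = integral {0..pi} (\<lambda>\<theta>. integral {0..2*pi} (F \<theta>))"
  proof -
    have "continuous_on (cbox (0,0) (pi, 2*pi)) (\<lambda>(\<theta>,\<phi>). F \<theta> \<phi>)"
      by (auto simp: F_def case_prod_unfold intro!: continuous_intros)
    from integral_prod_continuous[OF this] show ?thesis by simp
  qed
  also have "\<dots> = integral {0..pi}
      (\<lambda>\<theta>. 2 * pi * (poly p (cos \<theta>) * zonal_mean (poly q) s (cos \<theta>) * sin \<theta>))"
  proof (rule integral_cong)
    fix \<theta> assume "\<theta> \<in> {0..pi}"
    then have "sin \<theta> = sqrt (1 - (cos \<theta>)\<^sup>2)" by (simp add: sin_ge_zero flip: sin_squared_eq)
    then show "integral {0..2*pi} (F \<theta>) =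
        2 * pi * (poly p (cos \<theta>) * zonal_mean (poly q) s (cos \<theta>) * sin \<theta>)"
      by (simp add: F_def[abs_def] zonal_mean_def mult_ac add.commute)
  qed
  also have "\<dots> = 4 * pi * legendre_ip (poly p) (zonal_mean (poly q) s)"
    by (subst legendre_ip_eq_integral_cos) (auto intro!: continuous_intros continuous_on_zonal_mean)
  finally show ?thesis by simp
qed

lemma zonal_pairing_eq_legendre_ip:
  assumes "norm \<eta> = 1" "norm \<zeta> = 1"
  shows "zonal_pairing (poly p) (poly q) \<eta> \<zeta> = legendre_ip (poly p) (zonal_mean (poly q) (\<eta> \<bullet> \<zeta>))"
proof -
  have pole: "norm (axis 3 1 :: real^3) = 1" by (simp add: norm_axis_1)
  with assms(1) obtain a where a: "norm a = 1" "rotation a pi \<eta> = axis 3 1"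
    using rotation_pi_swap by metis
  have "rotation a pi \<zeta> $ 3 = \<eta> \<bullet> \<zeta>"
    using inner_rotation[OF a(1), of pi \<eta> \<zeta>] by (simp add: a(2) inner_axis')
  moreover have "norm (rotation a pi \<zeta>) = 1"
    using assms(2) inner_rotation[OF a(1)] by (simp add: norm_eq_1)
  ultimately obtain t where t: "rotation (axis 3 1) t (meridian (\<eta> \<bullet> \<zeta>)) = rotation a pi \<zeta>"
    using rotation_meridian by metis
  have "zonal_pairing (poly p) (poly q) \<eta> \<zeta> =
      zonal_pairing (poly p) (poly q) (axis 3 1) (rotation a pi \<zeta>)"
    using zonal_pairing_rotation[OF a(1)] a(2) by metis
  also have "\<dots> = zonal_pairing (poly p) (poly q) (axis 3 1) (meridian (\<eta> \<bullet> \<zeta>))"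
    using zonal_pairing_rotation[OF pole] rotation_axis[OF pole] t by metis
  finally show ?thesis by (simp add: zonal_pairing_meridian)
qed

definition cos_moment :: "nat \<Rightarrow> real" where
  "cos_moment j = integral {0..2*pi} (\<lambda>\<phi>. cos \<phi> ^ j) / (2 * pi)"

lemma cos_moment_odd:
  assumes "odd j"
  shows "cos_moment j = 0"
proof -
  obtain i where j: "j = 2 * i + 1" using assms by (rule oddE)
  have "((\<lambda>\<phi>. cos \<phi> *\<^sub>R (1 - (sin \<phi>)\<^sup>2) ^ i) has_integral
      (integral {sin 0..sin (2*pi)} (\<lambda>x. (1 - x\<^sup>2) ^ i)
        - integral {sin (2*pi)..sin 0} (\<lambda>x. (1 - x\<^sup>2) ^ i)))
      {0..2*pi}"
    by (rule has_integral_substitution_general[where s = "{}" and c = "-1" and d = 1])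
      (auto intro!: continuous_intros derivative_eq_intros)
  then have "((\<lambda>\<phi>. cos \<phi> ^ j) has_integral 0) {0..2*pi}"
    by (simp add: j power_mult flip: cos_squared_eq)
  then show ?thesis by (simp add: cos_moment_def integral_unique)
qed

lemma zonal_mean_power:
  "zonal_mean (\<lambda>x. x ^ m) s t =
     (\<Sum>j\<le>m. real (m choose j) * (sqrt (1 - s\<^sup>2) * sqrt (1 - t\<^sup>2)) ^ j * (s * t) ^ (m - j)
       * cos_moment j)"
proof -
  define a where "a j = real (m choose j) * (sqrt (1 - s\<^sup>2) * sqrt (1 - t\<^sup>2)) ^ j * (s * t) ^ (m - j)"
    for j
  have "zonal_mean (\<lambda>x. x ^ m) s t = integral {0..2*pi} (\<lambda>\<phi>. \<Sum>j\<le>m. a j * cos \<phi> ^ j) / (2 * pi)"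
    unfolding zonal_mean_def a_def
    by (subst add.commute) (simp add: binomial_ring power_mult_distrib mult_ac)
  also have "\<dots> = (\<Sum>j\<le>m. a j * cos_moment j)"
    by (subst integral_sum) (auto intro!: integrable_continuous_real continuous_intros
        simp: cos_moment_def sum_divide_distrib)
  finally show ?thesis by (simp only: a_def)
qed

lemma zonal_mean_power_is_poly:
  "\<exists>q. degree q \<le> m \<and> (\<forall>t\<in>{-1..1}. poly q t = zonal_mean (\<lambda>x. x ^ m) s t)"
proof -
  define a where "a j = real (m choose j) * cos_moment j * s ^ (m - j) * sqrt (1 - s\<^sup>2) ^ j" for j
  define q where "q = (\<Sum>j\<le>m. smult (a j) ([:1, 0, -1:] ^ (j div 2) * monom 1 (m - j)))"
  have "degree q \<le> m"
    unfolding q_def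
  proof (intro degree_sum_le order.trans[OF degree_smult_le] order.trans[OF degree_mult_le])
    fix j assume "j \<in> {..m}"
    have "degree ([:1, 0, -1:] ^ (j div 2) :: real poly) \<le> 2 * (j div 2)"
      by (rule order.trans[OF degree_power_le]) simp
    then show "degree ([:1, 0, -1:] ^ (j div 2) :: real poly)
        + degree (monom (1::real) (m - j)) \<le> m"
      using \<open>j \<in> {..m}\<close> by (simp add: degree_monom_eq)
  qed simp
  moreover have "poly q t = zonal_mean (\<lambda>x. x ^ m) s t" if "t \<in> {-1..1}" for t
    unfolding q_def poly_sum zonal_mean_power
  proof (intro sum.cong refl)
    fix j
    have "0 \<le> 1 - t\<^sup>2" using that by (simp add: abs_square_le_1 abs_le_iff)
    then have "sqrt (1 - t\<^sup>2) ^ j = (1 - t\<^sup>2) ^ (j div 2)" if "even j"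
      using that by (metis dvd_mult_div_cancel power_mult real_sqrt_pow2)
    then show "poly (smult (a j) ([:1, 0, -1:] ^ (j div 2) * monom 1 (m - j))) t =
        real (m choose j) * (sqrt (1 - s\<^sup>2) * sqrt (1 - t\<^sup>2)) ^ j * (s * t) ^ (m - j)
          * cos_moment j"
      by (cases "even j")
        (simp_all add: a_def cos_moment_odd poly_monom power_mult_distrib power2_eq_square mult_ac)
  qed
  ultimately show ?thesis by blast
qed

lemma zonal_mean_poly_is_poly:
  obtains q where "degree q \<le> degree p" "\<And>t. t \<in> {-1..1} \<Longrightarrow> poly q t = zonal_mean (poly p) s t"
proof -
  obtain q where q: "\<And>m. degree (q m) \<le> m"
    "\<And>m t. t \<in> {-1..1} \<Longrightarrow> poly (q m) t = zonal_mean (\<lambda>x. x ^ m) s t"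
    using zonal_mean_power_is_poly[of _ s] by metis
  define r where "r = (\<Sum>m\<le>degree p. smult (coeff p m) (q m))"
  have "degree r \<le> degree p"
    unfolding r_def
    by (intro degree_sum_le) (auto intro!: order.trans[OF degree_smult_le] order.trans[OF q(1)])
  moreover have "poly r t = zonal_mean (poly p) s t" if "t \<in> {-1..1}" for t
  proof -
    have "zonal_mean (poly p) s t = (\<Sum>m\<le>degree p. coeff p m * zonal_mean (\<lambda>x. x ^ m) s t)"
      unfolding zonal_mean_def poly_altdef
      by (subst integral_sum) (auto intro!: integrable_continuous_real continuous_intros
          simp: sum_divide_distrib)
    then show ?thesis using that by (simp add: r_def poly_sum q(2))
  qed
  ultimately show thesis by (rule that)
qed

lemma zonal_mean_selfadjoint:
  assumes "\<bar>s\<bar> \<le> 1"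
  shows "legendre_ip (poly p) (zonal_mean (poly q) s) =
    legendre_ip (poly q) (zonal_mean (poly p) s)"
proof -
  have "norm (axis 3 1 :: real^3) = 1" by (simp add: norm_axis_1)
  from zonal_pairing_swap[OF this norm_meridian[OF assms]] show ?thesis
    by (simp add: zonal_pairing_meridian)
qed

text \<open>Averaging is selfadjoint and does not raise the degree, so it is diagonal in the Legendre
  basis; the eigenvalue is read off at the pole $t = 1$.\<close>

lemma zonal_mean_legendre:
  assumes "s \<in> {-1..1}" "t \<in> {-1..1}"
  shows "zonal_mean (poly (legendre l)) s t = poly (legendre l) s * poly (legendre l) t"
proof -
  obtain q where q: "degree q \<le> degree (legendre l)"
      "\<And>t. t \<in> {-1..1} \<Longrightarrow> poly q t = zonal_mean (poly (legendre l)) s t"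
    using zonal_mean_poly_is_poly by metis
  obtain a where a: "q = (\<Sum>m\<le>l. smult (a m) (legendre m))"
    using legendre_span[OF order.trans[OF q(1) degree_legendre_le]] by blast
  have "a m = 0" if "m < l" for m
  proof -
    obtain q' where q': "degree q' \<le> degree (legendre m)"
        "\<And>t. t \<in> {-1..1} \<Longrightarrow> poly q' t = zonal_mean (poly (legendre m)) s t"
      using zonal_mean_poly_is_poly by metis
    have "legendre_ip (poly (legendre m)) (poly q) =
        legendre_ip (poly (legendre m)) (zonal_mean (poly (legendre l)) s)"
      using q(2) by (rule legendre_ip_cong)
    also have "\<dots> = legendre_ip (poly (legendre l)) (zonal_mean (poly (legendre m)) s)"
      using assms(1) by (intro zonal_mean_selfadjoint) auto
    also have "\<dots> = legendre_ip (poly (legendre l)) (poly q')"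
      using q'(2) by (intro legendre_ip_cong) simp
    also have "\<dots> = 0"
      using q'(1) degree_legendre_le[of m] that by (intro legendre_ip_legendre_low_degree) simp
    also have "legendre_ip (poly (legendre m)) (poly q) = a m * (1 / (2 * real m + 1))"
      unfolding a legendre_ip_poly_sum using that
      by (subst sum.remove[of _ m]) (auto simp: legendre_ip_legendre_self legendre_ip_legendre_neq)
    moreover have "2 * real m + 1 \<noteq> 0" by linarith
    ultimately show ?thesis by simp
  qed
  then have q_eq: "q = smult (a l) (legendre l)"
    unfolding a by (subst sum.remove[of _ l]) auto
  then have "a l = zonal_mean (poly (legendre l)) s 1"
    using q(2)[of 1] by simp
  also have "\<dots> = poly (legendre l) s" by (simp add: zonal_mean_def)
  finally show ?thesis using q(2)[OF assms(2)] by (simp add: q_eq)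
qed

lemma zonal_pairing_legendre:
  assumes "norm \<eta> = 1" "norm \<zeta> = 1"
  shows "zonal_pairing (poly (legendre l)) (poly (legendre m)) \<eta> \<zeta> =
    (if l = m then poly (legendre l) (\<eta> \<bullet> \<zeta>) / (2 * real l + 1) else 0)"
proof -
  have "\<bar>\<eta> \<bullet> \<zeta>\<bar> \<le> 1" using Cauchy_Schwarz_ineq2[of \<eta> \<zeta>] assms by simp
  then have "legendre_ip (poly (legendre l)) (zonal_mean (poly (legendre m)) (\<eta> \<bullet> \<zeta>)) =
      legendre_ip (poly (legendre l)) (poly (smult (poly (legendre m) (\<eta> \<bullet> \<zeta>)) (legendre m)))"
    by (intro legendre_ip_cong) (simp add: zonal_mean_legendre abs_le_iff)
  also have "\<dots> = poly (legendre m) (\<eta> \<bullet> \<zeta>) * legendre_ip (poly (legendre l)) (poly (legendre m))"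
    by (simp add: legendre_ip_def mult.left_commute[of _ "poly (legendre m) (\<eta> \<bullet> \<zeta>)"])
  finally show ?thesis
    using assms
    by (simp add: zonal_pairing_eq_legendre_ip legendre_ip_legendre_self legendre_ip_legendre_neq)
qed

text \<open>Evaluate the product formula at a point where $|P_l|$ is maximal.\<close>

lemma abs_poly_legendre_le_1:
  assumes "\<bar>t\<bar> \<le> 1"
  shows "\<bar>poly (legendre l) t\<bar> \<le> 1"
proof -
  obtain s where s: "s \<in> {-1..1}"
    and max: "\<And>x. x \<in> {-1..1} \<Longrightarrow> \<bar>poly (legendre l) x\<bar> \<le> \<bar>poly (legendre l) s\<bar>"
    using continuous_attains_sup[of "{-1..1::real}" "\<lambda>x. \<bar>poly (legendre l) x\<bar>"]
    by (force intro!: continuous_intros)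
  have range: "s * t + sqrt (1 - s\<^sup>2) * sqrt (1 - t\<^sup>2) * cos \<phi> \<in> {-1..1}" for \<phi>
  proof -
    have "s * t + sqrt (1 - s\<^sup>2) * sqrt (1 - t\<^sup>2) * cos \<phi> = sph 1 (arccos t) \<phi> \<bullet> meridian s"
      using assms by (simp add: sph_def meridian_def inner_vec_def sum_3 sin_arccos_abs mult_ac)
    also have "\<bar>\<dots>\<bar> \<le> 1"
      using Cauchy_Schwarz_ineq2[of "sph 1 (arccos t) \<phi>" "meridian s"] norm_meridian[of s] s
      by (simp add: norm_sph_1 abs_le_iff)
    finally show ?thesis by (auto simp: abs_le_iff)
  qed
  have "norm (integral {0..2*pi}
        (\<lambda>\<phi>. poly (legendre l) (s * t + sqrt (1 - s\<^sup>2) * sqrt (1 - t\<^sup>2) * cos \<phi>)))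
      \<le> \<bar>poly (legendre l) s\<bar> * (2 * pi - 0)"
    by (rule integral_bound) (auto intro!: continuous_intros max[OF range])
  then have "\<bar>zonal_mean (poly (legendre l)) s t\<bar> \<le> \<bar>poly (legendre l) s\<bar>"
    by (simp add: zonal_mean_def field_simps)
  moreover have "t \<in> {-1..1}" using assms by (simp add: abs_le_iff)
  ultimately have "\<bar>poly (legendre l) s\<bar> * \<bar>poly (legendre l) t\<bar> \<le> \<bar>poly (legendre l) s\<bar> * 1"
    using s by (simp add: zonal_mean_legendre abs_mult)
  moreover have "0 < \<bar>poly (legendre l) s\<bar>"
    using max[of 1] by simp
  ultimately show ?thesis by simp
qed

section \<open>Multipole expansion of the kernel\<close>

lemma summable_legendre:
  assumes "\<bar>u\<bar> \<le> 1" "\<bar>z\<bar> < 1"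
  shows "summable (\<lambda>n. poly (legendre n) u * z ^ n)"
proof (rule summable_comparison_test)
  show "summable (\<lambda>n. \<bar>z\<bar> ^ n)" using assms(2) by (intro summable_geometric) simp
  show "\<exists>N. \<forall>n\<ge>N. norm (poly (legendre n) u * z ^ n) \<le> \<bar>z\<bar> ^ n"
    using abs_poly_legendre_le_1[OF assms(1)]
    by (auto simp: abs_mult power_abs intro!: mult_left_le_one_le)
qed

lemma legendre_generating_ode:
  fixes u z :: real
  defines "P \<equiv> \<lambda>n. poly (legendre n) u"
  assumes u: "\<bar>u\<bar> \<le> 1" and z: "\<bar>z\<bar> < 1"
  shows "(1 - 2 * u * z + z\<^sup>2) * (\<Sum>n. diffs P n * z ^ n) = (u - z) * (\<Sum>n. P n * z ^ n)"
proof -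
  define F where "F = (\<Sum>n. P n * z ^ n)"
  define F' where "F' = (\<Sum>n. diffs P n * z ^ n)"
  have F: "(\<lambda>n. P n * z ^ n) sums F"
    using summable_legendre[OF u z] by (simp add: F_def P_def summable_sums)
  have F': "(\<lambda>n. diffs P n * z ^ n) sums F'"
    unfolding F'_def
    by (rule summable_sums, rule termdiff_converges[where K = 1])
      (use z summable_legendre[OF u] in \<open>auto simp: P_def\<close>)
  have F_Suc: "(\<lambda>n. P (Suc n) * z ^ Suc n) sums (F - 1)"
    using F by (subst sums_Suc_iff) (simp add: P_def)
  have F'_Suc: "(\<lambda>n. diffs P (Suc n) * z ^ Suc n) sums (F' - u)"
    using F' by (subst sums_Suc_iff) (simp add: P_def diffs_def)
  have zF': "(\<lambda>n. real n * P n * z ^ n) sums (z * F')"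
    using sums_mult[OF F', of z] sums_Suc_iff[of "\<lambda>n. real n * P n * z ^ n" "z * F'"]
    by (simp add: diffs_def mult_ac)
  have "(\<lambda>n. diffs P (Suc n) * z ^ Suc n - 2 * u * (z * (diffs P n * z ^ n))
      - u * (P (Suc n) * z ^ Suc n) + z * (real n * P n * z ^ n) + z * (P n * z ^ n)) sums
      ((F' - u) - 2 * u * (z * F') - u * (F - 1) + z * (z * F') + z * F)"
    by (intro sums_add sums_diff sums_mult F F_Suc F' F'_Suc zF')
  moreover have "diffs P (Suc n) * z ^ Suc n - 2 * u * (z * (diffs P n * z ^ n))
      - u * (P (Suc n) * z ^ Suc n) + z * (real n * P n * z ^ n) + z * (P n * z ^ n) =
      z ^ Suc n * ((real n + 2) * P (Suc (Suc n))
        - ((2 * real n + 3) * u * P (Suc n) - (real n + 1) * P n))" for n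
    by (simp add: diffs_def algebra_simps)
  ultimately have "(F' - u) - 2 * u * (z * F') - u * (F - 1) + z * (z * F') + z * F = 0"
    using sums_unique2[OF _ sums_zero] by (simp add: P_def poly_legendre_Suc_Suc)
  then show ?thesis unfolding F_def[symmetric] F'_def[symmetric] by algebra
qed

lemma legendre_generating_quadratic_pos:
  fixes u z :: real
  assumes "\<bar>u\<bar> \<le> 1" "0 \<le> z" "z < 1"
  shows "0 < 1 - 2 * u * z + z\<^sup>2"
proof -
  have "0 < (1 - z)\<^sup>2" "0 \<le> 2 * z * (1 - u)" using assms by auto
  then have "0 < (1 - z)\<^sup>2 + 2 * z * (1 - u)" by linarith
  then show ?thesis by (simp add: algebra_simps power2_eq_square)
qed

lemma DERIV_legendre_series_times_sqrt:
  fixes u x :: real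
  assumes u: "\<bar>u\<bar> \<le> 1" and x: "0 \<le> x" "x < 1"
  shows "((\<lambda>z. (\<Sum>n. poly (legendre n) u * z ^ n) * sqrt (1 - 2 * u * z + z\<^sup>2))
    has_real_derivative 0) (at x)"
proof -
  define P where "P = (\<lambda>n. poly (legendre n) u)"
  define F where "F = (\<lambda>z. \<Sum>n. P n * z ^ n)"
  define F' where "F' = (\<Sum>n. diffs P n * x ^ n)"
  define Q where "Q = (\<lambda>z. 1 - 2 * u * z + z\<^sup>2)"
  have Q_pos: "0 < Q x"
    using legendre_generating_quadratic_pos[OF u x] by (simp add: Q_def)
  have "norm x < norm ((x + 1) / 2)" "\<bar>(x + 1) / 2\<bar> < 1" using x by auto
  then have "(F has_real_derivative F') (at x)"
    unfolding F_def F'_def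
    by (intro termdiffs_strong[where K = "(x + 1) / 2"]) (auto simp: P_def summable_legendre u)
  moreover have "((\<lambda>z. sqrt (Q z)) has_real_derivative (x - u) / sqrt (Q x)) (at x)"
    using Q_pos unfolding Q_def by (auto intro!: derivative_eq_intros simp: field_simps)
  ultimately have "((\<lambda>z. F z * sqrt (Q z)) has_real_derivative
      F' * sqrt (Q x) + (x - u) / sqrt (Q x) * F x) (at x)"
    by (rule DERIV_mult)
  also have "F' * sqrt (Q x) + (x - u) / sqrt (Q x) * F x = (Q x * F' - (u - x) * F x) / sqrt (Q x)"
    using Q_pos by (simp add: field_simps)
  also have "Q x * F' = (u - x) * F x"
    using legendre_generating_ode[OF u, of x] x by (simp add: Q_def F_def F'_def P_def)
  finally show ?thesis by (simp add: F_def P_def Q_def)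
qed

lemma legendre_generating_function:
  fixes u z :: real
  assumes u: "\<bar>u\<bar> \<le> 1" and z: "0 \<le> z" "z < 1"
  shows "(\<lambda>l. poly (legendre l) u * z ^ l) sums (1 / sqrt (1 - 2 * u * z + z\<^sup>2))"
proof -
  define F where "F = (\<lambda>z. \<Sum>n. poly (legendre n) u * z ^ n)"
  define Q where "Q = (\<lambda>z. 1 - 2 * u * z + z\<^sup>2)"
  have deriv: "((\<lambda>z. F z * sqrt (Q z)) has_real_derivative 0) (at x)" if "0 \<le> x" "x < 1" for x
    unfolding F_def Q_def by (rule DERIV_legendre_series_times_sqrt[OF u that])
  have "F z * sqrt (Q z) = F 0 * sqrt (Q 0)"
  proof (cases "z = 0")
    case False
    then show ?thesis
      by (intro DERIV_isconst2[of 0 z "\<lambda>z. F z * sqrt (Q z)"])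
        (use z deriv in \<open>auto intro!: continuous_at_imp_continuous_on DERIV_isCont[OF deriv]\<close>)
  qed simp
  also have "\<dots> = 1"
    using powser_zero[of "\<lambda>n. poly (legendre n) u"] by (simp add: F_def Q_def)
  finally have "F z = 1 / sqrt (Q z)"
    using legendre_generating_quadratic_pos[OF u z] by (simp add: Q_def field_simps)
  then show ?thesis
    using summable_sums[OF summable_legendre[OF u, of z]] z by (simp add: F_def Q_def)
qed

text \<open>At $x = 0$ the junk direction $\mathrm{sgn}\,0 = 0$ is harmless: only the term $l = 0$ is
  nonzero there, and $P_0$ is constant.\<close>

definition multipole :: "nat \<Rightarrow> real^3 \<Rightarrow> real^3 \<Rightarrow> real" where
  "multipole l x y = norm x ^ l / norm y ^ (l + 1) * poly (legendre l) (sgn x \<bullet> sgn y)"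

lemma abs_inner_sgn_le_1: "\<bar>sgn x \<bullet> sgn y\<bar> \<le> 1" for x y :: "'a::real_inner"
proof -
  have "\<bar>sgn x \<bullet> sgn y\<bar> \<le> norm (sgn x) * norm (sgn y)" by (rule Cauchy_Schwarz_ineq2)
  then show ?thesis by (auto simp: norm_sgn split: if_splits)
qed

lemma multipole_sums_kernel:
  assumes "norm x < norm y"
  shows "(\<lambda>l. multipole l x y) sums kernel x y"
proof -
  define u where "u = sgn x \<bullet> sgn y"
  define \<rho> where "\<rho> = norm x / norm y"
  have y: "0 < norm y" using assms norm_ge_zero[of x] by linarith
  have "x \<bullet> y = norm x * norm y * u"
    using y by (cases "x = 0") (simp_all add: u_def sgn_div_norm field_simps)
  then have "(norm (x - y))\<^sup>2 = (norm x)\<^sup>2 - 2 * (norm x * norm y * u) + (norm y)\<^sup>2"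
    using dot_norm_neg[of x y] by simp
  also have "\<dots> = (norm y)\<^sup>2 * (1 - 2 * u * \<rho> + \<rho>\<^sup>2)"
    using y by (simp add: \<rho>_def field_simps power2_eq_square)
  finally have "norm (x - y) = norm y * sqrt (1 - 2 * u * \<rho> + \<rho>\<^sup>2)"
    by (metis abs_norm_cancel real_sqrt_abs real_sqrt_mult)
  then have "kernel x y = 1 / norm y * (1 / sqrt (1 - 2 * u * \<rho> + \<rho>\<^sup>2))"
    by (simp add: kernel_def)
  moreover have "(\<lambda>l. 1 / norm y * (poly (legendre l) u * \<rho> ^ l)) sums
      (1 / norm y * (1 / sqrt (1 - 2 * u * \<rho> + \<rho>\<^sup>2)))"
    by (intro sums_mult legendre_generating_function)
      (use assms y in \<open>auto simp: u_def \<rho>_def abs_inner_sgn_le_1\<close>)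
  ultimately show ?thesis by (simp add: multipole_def u_def \<rho>_def power_divide mult_ac)
qed

lemma abs_multipole_le: "\<bar>multipole l x y\<bar> \<le> norm x ^ l / norm y ^ (l + 1)"
  using mult_left_mono[OF abs_poly_legendre_le_1[OF abs_inner_sgn_le_1[of x y]],
      of "norm x ^ l / norm y ^ (l + 1)" l]
  by (simp add: multipole_def abs_mult)

lemma abs_tail_le_geometric:
  fixes f :: "nat \<Rightarrow> real"
  assumes "f sums s" and \<rho>: "0 \<le> \<rho>" "\<rho> < 1" and f: "\<And>l. \<bar>f l\<bar> \<le> a * \<rho> ^ l"
  shows "\<bar>s - (\<Sum>l\<le>c. f l)\<bar> \<le> a * \<rho> ^ (c + 1) / (1 - \<rho>)"
proof -
  have "(\<lambda>l. f (l + (c + 1))) sums (s - (\<Sum>l\<le>c. f l))"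
    using sums_split_initial_segment[OF assms(1), of "c + 1"] by (simp add: lessThan_Suc_atMost)
  moreover have "(\<lambda>l. a * \<rho> ^ (c + 1) * \<rho> ^ l) sums (a * \<rho> ^ (c + 1) * (1 / (1 - \<rho>)))"
    by (intro sums_mult geometric_sums) (use \<rho> in auto)
  moreover have "norm (f (l + (c + 1))) \<le> a * \<rho> ^ (c + 1) * \<rho> ^ l" for l
    using f[of "l + (c + 1)"] by (simp add: power_add mult_ac)
  ultimately show ?thesis
    using norm_suminf_le[of "\<lambda>l. f (l + (c + 1))" "\<lambda>l. a * \<rho> ^ (c + 1) * \<rho> ^ l"]
    by (simp add: sums_iff)
qed

lemma abs_kernel_diff_multipoles_le:
  assumes x: "norm x \<le> r1" and "r1 < r2" and y: "r2 \<le> norm y"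
  shows "\<bar>kernel x y - (\<Sum>l\<le>c. multipole l x y)\<bar> \<le> (r1 / r2) ^ (c + 1) / (r2 - r1)"
proof -
  have pos: "0 \<le> r1" "0 < r2" using assms norm_ge_zero[of x] by linarith+
  have "\<bar>multipole l x y\<bar> \<le> 1 / r2 * (r1 / r2) ^ l" for l
  proof -
    have "norm x ^ l / norm y ^ (l + 1) \<le> r1 ^ l / r2 ^ (l + 1)"
      using x y pos by (intro frac_le power_mono) auto
    with abs_multipole_le[of l x y] show ?thesis by (simp add: power_divide)
  qed
  then have "\<bar>kernel x y - (\<Sum>l\<le>c. multipole l x y)\<bar> \<le> 1 / r2 * (r1 / r2) ^ (c + 1) / (1 - r1 / r2)"
    by (intro abs_tail_le_geometric multipole_sums_kernel) (use assms pos in auto)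
  also have "\<dots> = (r1 / r2) ^ (c + 1) / (r2 - r1)"
    using pos assms(2) by (simp add: field_simps)
  finally show ?thesis .
qed

section \<open>Polynomials in three variables\<close>

lemma finite_exponents: "finite {(i, j, l). i + j + l \<le> (d::nat)}"
  by (rule finite_subset[of _ "{..d} \<times> {..d} \<times> {..d}"]) auto

lemma poly3_deg_le_0: "poly3_deg_le d (\<lambda>x. 0)"
  unfolding poly3_deg_le_def by (rule exI[of _ "\<lambda>_ _ _. 0"]) (auto intro!: sum.neutral[symmetric])

lemma poly3_deg_le_add:
  assumes "poly3_deg_le d p" "poly3_deg_le d q"
  shows "poly3_deg_le d (\<lambda>x. p x + q x)"
proof -
  obtain a b where
    "\<And>x. p x = (\<Sum>(i,j,l) \<in> {(i,j,l). i + j + l \<le> d}. a i j l * (x$1)^i * (x$2)^j * (x$3)^l)"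
    "\<And>x. q x = (\<Sum>(i,j,l) \<in> {(i,j,l). i + j + l \<le> d}. b i j l * (x$1)^i * (x$2)^j * (x$3)^l)"
    using assms unfolding poly3_deg_le_def by blast
  then show ?thesis
    unfolding poly3_deg_le_def
    by (intro exI[of _ "\<lambda>i j l. a i j l + b i j l"])
      (auto simp: case_prod_unfold algebra_simps simp flip: sum.distrib)
qed

lemma poly3_deg_le_sum:
  assumes "\<And>s. s \<in> A \<Longrightarrow> poly3_deg_le d (p s)"
  shows "poly3_deg_le d (\<lambda>x. \<Sum>s\<in>A. p s x)"
  using assms
  by (induction A rule: infinite_finite_induct) (simp_all add: poly3_deg_le_0 poly3_deg_le_add)

lemma poly3_deg_le_monomial:
  assumes "i + j + l \<le> d"
  shows "poly3_deg_le d (\<lambda>x. a * (x$1)^i * (x$2)^j * (x$3)^l)"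
  unfolding poly3_deg_le_def
proof (intro exI allI)
  fix x :: "real^3"
  let ?b = "\<lambda>i' j' l'. if (i',j',l') = (i,j,l) then a else 0"
  have "(\<Sum>(i',j',l') \<in> {(i,j,l). i + j + l \<le> d}. ?b i' j' l' * (x$1)^i' * (x$2)^j' * (x$3)^l') =
      (\<Sum>m \<in> {(i,j,l). i + j + l \<le> d}. if m = (i,j,l) then a * (x$1)^i * (x$2)^j * (x$3)^l else 0)"
    by (intro sum.cong refl) (simp add: case_prod_unfold prod_eq_iff)
  then show "a * (x$1)^i * (x$2)^j * (x$3)^l =
      (\<Sum>(i',j',l') \<in> {(i,j,l). i + j + l \<le> d}. ?b i' j' l' * (x$1)^i' * (x$2)^j' * (x$3)^l')"
    using assms by (simp add: finite_exponents)
qed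

lemma poly3_deg_le_const: "poly3_deg_le d (\<lambda>x. a)"
  using poly3_deg_le_monomial[of 0 0 0 d a] by simp

lemma poly3_deg_le_inner: "poly3_deg_le 1 (\<lambda>x. x \<bullet> \<eta>)"
proof -
  have "poly3_deg_le 1 (\<lambda>x. \<eta>$1 * (x$1)^1 * (x$2)^0 * (x$3)^0 +
      (\<eta>$2 * (x$1)^0 * (x$2)^1 * (x$3)^0 + \<eta>$3 * (x$1)^0 * (x$2)^0 * (x$3)^1))"
    by (intro poly3_deg_le_add poly3_deg_le_monomial) auto
  then show ?thesis by (simp add: inner_vec_def sum_3 mult_ac add_ac)
qed

lemma poly3_deg_le_mult:
  assumes "poly3_deg_le d p" "poly3_deg_le e q"
  shows "poly3_deg_le (d + e) (\<lambda>x. p x * q x)"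
proof -
  obtain a b where
    p: "\<And>x. p x = (\<Sum>(i,j,l) \<in> {(i,j,l). i + j + l \<le> d}. a i j l * (x$1)^i * (x$2)^j * (x$3)^l)"
    and q: "\<And>x. q x = (\<Sum>(i,j,l) \<in> {(i,j,l). i + j + l \<le> e}. b i j l * (x$1)^i * (x$2)^j * (x$3)^l)"
    using assms unfolding poly3_deg_le_def by blast
  have "poly3_deg_le (d + e) (\<lambda>x. a i j l * (x$1)^i * (x$2)^j * (x$3)^l *
      (b i' j' l' * (x$1)^i' * (x$2)^j' * (x$3)^l'))"
    if "i + j + l \<le> d" "i' + j' + l' \<le> e" for i j l i' j' l'
    using poly3_deg_le_monomial[of "i + i'" "j + j'" "l + l'" "d + e" "a i j l * b i' j' l'"] that
    by (simp add: power_add mult_ac)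
  then show ?thesis
    unfolding p q sum_product by (auto intro!: poly3_deg_le_sum simp: case_prod_unfold)
qed

lemma poly3_deg_le_poly:
  assumes "poly3_deg_le e p" "degree f \<le> n"
  shows "poly3_deg_le (n * e) (\<lambda>x. poly f (p x))"
  using assms(2)
proof (induction f arbitrary: n)
  case 0
  then show ?case by (simp add: poly3_deg_le_0)
next
  case (pCons a f)
  show ?case
  proof (cases "f = 0")
    case True
    then show ?thesis by (simp add: poly3_deg_le_const)
  next
    case False
    then obtain m where n: "n = Suc m" "degree f \<le> m"
      using pCons.prems by (cases n) auto
    then show ?thesis
      using poly3_deg_le_add[OF poly3_deg_le_const poly3_deg_le_mult[OF assms(1) pCons.IH]] by simp
  qed
qed

section \<open>Spherical designs\<close>

definition avg :: "'a set \<Rightarrow> ('a \<Rightarrow> real) \<Rightarrow> real" where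
  "avg Y f = (\<Sum>y\<in>Y. f y) / card Y"

definition rms :: "('a \<Rightarrow> real) \<Rightarrow> 'a set \<Rightarrow> real" where
  "rms f Y = L2_set f Y / sqrt (card Y)"

lemma avg_linear_combination: "avg Y (\<lambda>y. \<Sum>i\<in>I. a i * f i y) = (\<Sum>i\<in>I. a i * avg Y (f i))"
  unfolding avg_def by (subst sum.swap) (simp add: sum_distrib_left sum_divide_distrib)

lemma avg_cong: "(\<And>y. y \<in> Y \<Longrightarrow> f y = g y) \<Longrightarrow> avg Y f = avg Y g"
  by (simp add: avg_def)

lemma rms_eq_sqrt_avg: "rms f Y = sqrt (avg Y (\<lambda>y. (f y)\<^sup>2))"
  by (simp add: rms_def L2_set_def avg_def real_sqrt_divide)

lemma abs_avg_mult_le: "\<bar>avg Y (\<lambda>y. f y * g y)\<bar> \<le> rms f Y * rms g Y"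
proof -
  have "\<bar>\<Sum>y\<in>Y. f y * g y\<bar> \<le> L2_set f Y * L2_set g Y"
    using order.trans[OF sum_abs L2_set_mult_ineq[of f g Y, folded abs_mult]] .
  then show ?thesis
    by (simp add: avg_def rms_def divide_right_mono)
qed

lemma rms_add_le: "rms (\<lambda>y. f y + g y) Y \<le> rms f Y + rms g Y"
  unfolding rms_def add_divide_distrib[symmetric]
  by (intro divide_right_mono L2_set_triangle_ineq) simp

lemma rms_le:
  assumes "finite Y" "Y \<noteq> {}" and B: "\<And>y. y \<in> Y \<Longrightarrow> \<bar>f y\<bar> \<le> B"
  shows "rms f Y \<le> B"
proof -
  have "0 \<le> B" using assms(2) B abs_ge_zero order.trans by blast
  have "L2_set f Y = L2_set (\<lambda>y. \<bar>f y\<bar>) Y" by (simp add: L2_set_def)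
  also have "\<dots> \<le> L2_set (\<lambda>y. B) Y" using B by (intro L2_set_mono) auto
  also have "\<dots> = sqrt (card Y) * B" using \<open>0 \<le> B\<close> by (simp add: L2_set_constant)
  finally show ?thesis
    using assms by (simp add: rms_def divide_le_eq card_gt_0_iff mult.commute)
qed

definition spherical_design :: "real \<Rightarrow> nat \<Rightarrow> (real^3) set \<Rightarrow> bool" where
  "spherical_design r d Y \<longleftrightarrow> finite Y \<and> Y \<noteq> {} \<and> Y \<subseteq> sphere 0 r \<and>
     (\<forall>p. poly3_deg_le d p \<longrightarrow> sphere_integral r p = 4 * pi * r\<^sup>2 / card Y * (\<Sum>y\<in>Y. p y))"

lemma sphere_integral_scale: "sphere_integral r f = r\<^sup>2 * sphere_integral 1 (\<lambda>x. f (r *\<^sub>R x))"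
proof -
  have "sph r \<theta> \<phi> = r *\<^sub>R sph 1 \<theta> \<phi>" for \<theta> \<phi>
    by (simp add: sph_def vec_eq_iff forall_3)
  then have "sphere_integral r f = integral (cbox (0,0) (pi, 2*pi))
      (\<lambda>t. r\<^sup>2 * (case t of (\<theta>,\<phi>) \<Rightarrow> f (r *\<^sub>R sph 1 \<theta> \<phi>) * 1\<^sup>2 * sin \<theta>))"
    by (simp add: sphere_integral_def case_prod_unfold mult_ac)
  then show ?thesis
    by (simp only: integral_mult_right sphere_integral_def)
qed

lemma spherical_design_avg_eq:
  assumes "0 < r" "spherical_design r d Y" "poly3_deg_le d p"
  shows "avg Y p = sphere_integral 1 (\<lambda>x. p (r *\<^sub>R x)) / (4 * pi)"
proof -
  have "r\<^sup>2 * sphere_integral 1 (\<lambda>x. p (r *\<^sub>R x)) = 4 * pi * r\<^sup>2 / card Y * (\<Sum>y\<in>Y. p y)"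
    using assms(2,3) unfolding spherical_design_def by (metis sphere_integral_scale)
  then have "r\<^sup>2 * sphere_integral 1 (\<lambda>x. p (r *\<^sub>R x)) = r\<^sup>2 * (4 * pi * avg Y p)"
    by (simp add: avg_def)
  then show ?thesis using assms(1) by simp
qed

lemma spherical_design_avg_legendre:
  assumes "0 < r" and Y: "spherical_design r (2*c) Y" and "l \<le> c" "m \<le> c"
    and "norm \<eta> = 1" "norm \<zeta> = 1"
  shows "avg Y (\<lambda>y. poly (legendre l) (sgn y \<bullet> \<eta>) * poly (legendre m) (sgn y \<bullet> \<zeta>)) =
    (if l = m then poly (legendre l) (\<eta> \<bullet> \<zeta>) / (2 * real l + 1) else 0)"
proof -
  define p where "p y = poly (legendre l) (y \<bullet> (\<eta> /\<^sub>R r)) * poly (legendre m) (y \<bullet> (\<zeta> /\<^sub>R r))" for y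
  have "poly3_deg_le (c * 1 + c * 1) p"
    unfolding p_def
    by (intro poly3_deg_le_mult poly3_deg_le_poly poly3_deg_le_inner
        order.trans[OF degree_legendre_le] assms)
  then have "avg Y p = zonal_pairing (poly (legendre l)) (poly (legendre m)) \<eta> \<zeta>"
    using spherical_design_avg_eq[OF assms(1) Y, of p] assms(1)
    by (simp add: p_def zonal_pairing_def mult_2 flip: mult.assoc)
  moreover have "sgn y = y /\<^sub>R r" if "y \<in> Y" for y
    using Y that by (auto simp: spherical_design_def sgn_div_norm)
  then have "avg Y p = avg Y (\<lambda>y. poly (legendre l) (sgn y \<bullet> \<eta>) * poly (legendre m) (sgn y \<bullet> \<zeta>))"
    by (intro avg_cong) (simp add: p_def)
  ultimately show ?thesis using assms by (simp add: zonal_pairing_legendre)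
qed

subsection \<open>The reproducing kernel\<close>

definition reproducing_kernel :: "nat \<Rightarrow> real \<Rightarrow> real^3 \<Rightarrow> real^3 \<Rightarrow> real" where
  "reproducing_kernel c t \<zeta> y =
     (\<Sum>m\<le>c. (2 * real m + 1) * t ^ (m + 1) * poly (legendre m) (sgn y \<bullet> \<zeta>))"

lemma avg_legendre_reproducing_kernel:
  assumes "0 < r" and Y: "spherical_design r (2*c) Y" and "l \<le> c" and "norm \<eta> = 1" "norm \<zeta> = 1"
  shows "avg Y (\<lambda>y. poly (legendre l) (sgn y \<bullet> \<eta>) * reproducing_kernel c t \<zeta> y) =
    t ^ (l + 1) * poly (legendre l) (\<eta> \<bullet> \<zeta>)"
proof -
  have "avg Y (\<lambda>y. poly (legendre l) (sgn y \<bullet> \<eta>) * reproducing_kernel c t \<zeta> y) =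
      avg Y (\<lambda>y. \<Sum>m\<le>c. ((2 * real m + 1) * t ^ (m + 1)) *
        (poly (legendre l) (sgn y \<bullet> \<eta>) * poly (legendre m) (sgn y \<bullet> \<zeta>)))"
    by (simp add: reproducing_kernel_def sum_distrib_left mult_ac)
  also have "\<dots> = (\<Sum>m\<le>c. (2 * real m + 1) * t ^ (m + 1) *
      (if l = m then poly (legendre l) (\<eta> \<bullet> \<zeta>) / (2 * real l + 1) else 0))"
    unfolding avg_linear_combination
    by (intro sum.cong refl arg_cong[where f = "(*) _"]
        spherical_design_avg_legendre[OF assms(1) Y])
      (use assms in auto)
  also have "\<dots> = (\<Sum>m\<le>c. if l = m then t ^ (l + 1) * poly (legendre l) (\<eta> \<bullet> \<zeta>) else 0)"
  proof (intro sum.cong refl)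
    have "2 * real l + 1 \<noteq> 0" by linarith
    then show "(2 * real m + 1) * t ^ (m + 1) *
        (if l = m then poly (legendre l) (\<eta> \<bullet> \<zeta>) / (2 * real l + 1) else 0) =
        (if l = m then t ^ (l + 1) * poly (legendre l) (\<eta> \<bullet> \<zeta>) else 0)" for m
      by simp
  qed
  finally show ?thesis using assms(3) by simp
qed

lemma rms_reproducing_kernel_le:
  assumes "0 < r" and Y: "spherical_design r (2*c) Y" and t: "0 \<le> t" "t \<le> 1" and "norm \<zeta> = 1"
  shows "rms (reproducing_kernel c t \<zeta>) Y \<le> real c + 1"
proof -
  have "avg Y (\<lambda>y. (reproducing_kernel c t \<zeta> y)\<^sup>2) =
      avg Y (\<lambda>y. \<Sum>m\<le>c. ((2 * real m + 1) * t ^ (m + 1)) *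
        (poly (legendre m) (sgn y \<bullet> \<zeta>) * reproducing_kernel c t \<zeta> y))"
    unfolding power2_eq_square
    by (subst (1) reproducing_kernel_def) (simp add: sum_distrib_left mult_ac)
  also have "\<dots> = (\<Sum>m\<le>c. (2 * real m + 1) * t ^ (m + 1) * t ^ (m + 1))"
    unfolding avg_linear_combination using assms norm_eq_1[of \<zeta>]
    by (simp add: avg_legendre_reproducing_kernel[OF assms(1) Y] mult.assoc)
  also have "\<dots> \<le> (\<Sum>m\<le>c. 2 * real m + 1)"
  proof (intro sum_mono)
    fix m
    have "t ^ (m + 1) * t ^ (m + 1) \<le> 1" using t by (intro mult_le_one power_le_one) auto
    from mult_left_mono[OF this, of "2 * real m + 1"]
    show "(2 * real m + 1) * t ^ (m + 1) * t ^ (m + 1) \<le> 2 * real m + 1" by (simp add: mult.assoc)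
  qed
  also have "\<dots> = (real c + 1)\<^sup>2"
    by (induction c) (simp_all add: power2_eq_square algebra_simps)
  finally show ?thesis
    by (simp add: rms_eq_sqrt_avg real_le_lsqrt)
qed

lemma multipole_scaleR:
  assumes "norm \<eta> = 1" "0 \<le> a"
  shows "multipole l (a *\<^sub>R \<eta>) y = a ^ l / norm y ^ (l + 1) * poly (legendre l) (\<eta> \<bullet> sgn y)"
proof (cases "a = 0")
  case True
  then show ?thesis by (cases l) (simp_all add: multipole_def)
next
  case False
  then show ?thesis using assms by (simp add: multipole_def sgn_div_norm)
qed

lemma avg_multipole_reproducing_kernel:
  assumes "0 < r" and Y: "spherical_design r (2*c) Y" and "l \<le> c" and "y\<^sub>0 \<noteq> 0"
  shows "avg Y (\<lambda>y. multipole l x y * reproducing_kernel c (r / norm y\<^sub>0) (sgn y\<^sub>0) y) =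
    multipole l x y\<^sub>0"
proof -
  let ?t = "r / norm y\<^sub>0"
  obtain \<eta> where \<eta>: "norm \<eta> = 1" "x = norm x *\<^sub>R \<eta>"
  proof (cases "x = 0")
    case True
    then show thesis using that[of "axis 1 1"] by (simp add: norm_axis_1)
  next
    case False
    then show thesis using that[of "sgn x"] by (simp add: norm_sgn sgn_div_norm)
  qed
  have multipole:
    "multipole l x y = norm x ^ l / norm y ^ (l + 1) * poly (legendre l) (sgn y \<bullet> \<eta>)" for y
    using multipole_scaleR[OF \<eta>(1) norm_ge_zero[of x], of l y] \<eta>(2) by (simp add: inner_commute)
  have "norm y = r" if "y \<in> Y" for y using Y that by (auto simp: spherical_design_def)
  then have "avg Y (\<lambda>y. multipole l x y * reproducing_kernel c ?t (sgn y\<^sub>0) y) =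
      avg Y (\<lambda>y. \<Sum>i\<in>{()}. norm x ^ l / r ^ (l + 1) *
        (poly (legendre l) (sgn y \<bullet> \<eta>) * reproducing_kernel c ?t (sgn y\<^sub>0) y))"
    by (intro avg_cong) (simp add: multipole)
  also have "\<dots> = norm x ^ l / r ^ (l + 1) * (?t ^ (l + 1) * poly (legendre l) (\<eta> \<bullet> sgn y\<^sub>0))"
    unfolding avg_linear_combination
    using assms \<eta>(1) by (simp add: avg_legendre_reproducing_kernel[OF assms(1) Y] norm_sgn)
  also have "\<dots> = multipole l x y\<^sub>0"
    using assms(1) by (simp add: multipole inner_commute power_divide)
  finally show ?thesis .
qed

section \<open>The error bound\<close>

definition potential :: "'i set \<Rightarrow> ('i \<Rightarrow> real) \<Rightarrow> ('i \<Rightarrow> real^3) \<Rightarrow> real^3 \<Rightarrow> real" where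
  "potential I w p y = (\<Sum>j\<in>I. w j * kernel (p j) y)"

definition truncated_potential ::
    "nat \<Rightarrow> 'i set \<Rightarrow> ('i \<Rightarrow> real) \<Rightarrow> ('i \<Rightarrow> real^3) \<Rightarrow> real^3 \<Rightarrow> real" where
  "truncated_potential c I w p y = (\<Sum>j\<in>I. w j * (\<Sum>l\<le>c. multipole l (p j) y))"

lemma abs_potential_diff_truncated_le:
  assumes "\<And>j. j \<in> I \<Longrightarrow> norm (p j) \<le> r1" "r1 < r2" "r2 \<le> norm y"
  shows "\<bar>potential I w p y - truncated_potential c I w p y\<bar> \<le>
    (\<Sum>j\<in>I. \<bar>w j\<bar>) * ((r1 / r2) ^ (c + 1) / (r2 - r1))"
proof -
  have "potential I w p y - truncated_potential c I w p y =
      (\<Sum>j\<in>I. w j * (kernel (p j) y - (\<Sum>l\<le>c. multipole l (p j) y)))"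
    by (simp add: potential_def truncated_potential_def sum_subtractf right_diff_distrib)
  also have "\<bar>\<dots>\<bar> \<le> (\<Sum>j\<in>I. \<bar>w j\<bar> * ((r1 / r2) ^ (c + 1) / (r2 - r1)))"
    by (intro order.trans[OF sum_abs] sum_mono)
      (use assms in \<open>auto simp only: abs_mult intro!: mult_left_mono abs_kernel_diff_multipoles_le\<close>)
  finally show ?thesis by (simp only: sum_distrib_right)
qed

lemma abs_truncated_potential_le_rms:
  assumes "0 < r" and Y: "spherical_design r (2*c) Y" and y\<^sub>0: "r \<le> norm y\<^sub>0"
  shows "\<bar>truncated_potential c I w p y\<^sub>0\<bar> \<le> (real c + 1) * rms (truncated_potential c I w p) Y"
proof -
  let ?K = "reproducing_kernel c (r / norm y\<^sub>0) (sgn y\<^sub>0)"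
  have "y\<^sub>0 \<noteq> 0" using assms by auto
  have "avg Y (\<lambda>y. truncated_potential c I w p y * ?K y) =
      avg Y (\<lambda>y. \<Sum>j\<in>I. w j * (\<Sum>l\<le>c. 1 * (multipole l (p j) y * ?K y)))"
    by (simp add: truncated_potential_def sum_distrib_right mult.assoc)
  also have "\<dots> = truncated_potential c I w p y\<^sub>0"
    unfolding avg_linear_combination truncated_potential_def
    using \<open>y\<^sub>0 \<noteq> 0\<close> by (simp add: avg_multipole_reproducing_kernel[OF assms(1) Y])
  finally have "\<bar>truncated_potential c I w p y\<^sub>0\<bar> \<le> rms (truncated_potential c I w p) Y * rms ?K Y"
    by (metis abs_avg_mult_le)
  also have "\<dots> \<le> rms (truncated_potential c I w p) Y * (real c + 1)"
    using assms \<open>y\<^sub>0 \<noteq> 0\<close>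
    by (intro mult_left_mono rms_reproducing_kernel_le[OF assms(1) Y]) (auto simp: norm_sgn rms_def)
  finally show ?thesis by (simp add: mult.commute)
qed

lemma abs_potential_le_rms:
  assumes r: "0 < r1" "r1 < r2" and Y: "spherical_design r2 (2*c) Y"
    and p: "\<And>j. j \<in> I \<Longrightarrow> norm (p j) \<le> r1" and y\<^sub>0: "r2 \<le> norm y\<^sub>0"
  shows "\<bar>potential I w p y\<^sub>0\<bar> \<le> (real c + 1) * rms (potential I w p) Y
    + (real c + 2) * ((\<Sum>j\<in>I. \<bar>w j\<bar>) * ((r1 / r2) ^ (c + 1) / (r2 - r1)))"
proof -
  let ?f = "potential I w p" and ?g = "truncated_potential c I w p"
  define \<tau> where "\<tau> = (\<Sum>j\<in>I. \<bar>w j\<bar>) * ((r1 / r2) ^ (c + 1) / (r2 - r1))"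
  have tail: "\<bar>?f y - ?g y\<bar> \<le> \<tau>" if "r2 \<le> norm y" for y
    unfolding \<tau>_def using p r(2) that by (intro abs_potential_diff_truncated_le) auto
  have "rms (\<lambda>y. ?g y - ?f y) Y \<le> \<tau>"
    using Y tail by (intro rms_le) (auto simp: spherical_design_def abs_minus_commute)
  then have "rms ?g Y \<le> rms ?f Y + \<tau>"
    using rms_add_le[of ?f "\<lambda>y. ?g y - ?f y" Y] by simp
  then have "(real c + 1) * rms ?g Y \<le> (real c + 1) * (rms ?f Y + \<tau>)"
    by (intro mult_left_mono) auto
  moreover have "\<bar>?g y\<^sub>0\<bar> \<le> (real c + 1) * rms ?g Y"
    using r y\<^sub>0 by (intro abs_truncated_potential_le_rms[OF _ Y]) auto
  ultimately have "\<bar>?f y\<^sub>0\<bar> \<le> (real c + 1) * (rms ?f Y + \<tau>) + \<tau>"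
    using tail[OF y\<^sub>0] by linarith
  then show ?thesis unfolding \<tau>_def[symmetric] by (simp add: algebra_simps)
qed

lemma l2_on_div_sqrt_card: "l2_on f Z / sqrt (card Z) = rms f Z"
  by (simp add: rms_def l2_on_def L2_set_def)

lemma err_eq_potential:
  "err x xr k U i = potential {..k} ((\<lambda>j. - U i j)(k := 1)) (xr(k := x i))"
  by (rule ext) (simp add: err_def potential_def sum_negf flip: lessThan_Suc_atMost)

lemma sum_abs_le_row_maxnorm: "(\<Sum>j<k. \<bar>U i j\<bar>) \<le> k * row_maxnorm U k i"
proof -
  have "\<bar>U i j\<bar> \<le> row_maxnorm U k i" if "j < k" for j
    unfolding row_maxnorm_def using that by (intro Max_ge) auto
  then have "(\<Sum>j<k. \<bar>U i j\<bar>) \<le> (\<Sum>j<k. row_maxnorm U k i)" by (intro sum_mono) auto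
  then show ?thesis by simp
qed

lemma abs_err_le_rms:
  fixes c k :: nat
  assumes r: "0 < r1" "r1 < r2" and Y: "spherical_design r2 (2*c) Y"
    and x: "norm (x i) \<le> r1" "\<And>j. j < k \<Longrightarrow> norm (xr j) \<le> r1" and y: "r2 \<le> norm y"
  shows "\<bar>err x xr k U i y\<bar> \<le> (c + 1) * rms (err x xr k U i) Y
    + (c + 2) * (1 + k * row_maxnorm U k i) / (r2 - r1) * (r1 / r2) ^ (c + 1)"
proof -
  define w where "w = (\<lambda>j. - U i j)(k := 1)"
  define q where "q = (r1 / r2) ^ (c + 1) / (r2 - r1)"
  have "\<bar>err x xr k U i y\<bar> \<le> (real c + 1) * rms (err x xr k U i) Y
      + (real c + 2) * ((\<Sum>j\<le>k. \<bar>w j\<bar>) * q)"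
    unfolding err_eq_potential w_def q_def
    by (rule abs_potential_le_rms[OF r Y _ y]) (use x in auto)
  also have "\<dots> \<le> (real c + 1) * rms (err x xr k U i) Y
      + (real c + 2) * ((1 + k * row_maxnorm U k i) * q)"
  proof -
    have "(\<Sum>j\<le>k. \<bar>w j\<bar>) \<le> 1 + k * row_maxnorm U k i"
      using sum_abs_le_row_maxnorm[of U i k] by (simp add: w_def flip: lessThan_Suc_atMost)
    then show ?thesis
      using r by (intro add_left_mono mult_left_mono mult_right_mono) (auto simp: q_def)
  qed
  finally show ?thesis by (simp add: q_def add.commute mult_ac)
qed

lemma rms_err_le:
  fixes c k :: nat
  assumes r: "0 < r1" "r1 < r2" and Y: "spherical_design r2 (2*c) Y"
    and x: "norm (x i) \<le> r1" "\<And>j. j < k \<Longrightarrow> norm (xr j) \<le> r1"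
    and Z: "finite Z" "Z \<noteq> {}" "Z \<subseteq> - ball 0 r2"
  shows "rms (err x xr k U i) Z \<le> (c + 1) * rms (err x xr k U i) Y
    + (c + 2) * (1 + k * row_maxnorm U k i) / (r2 - r1) * (r1 / r2) ^ (c + 1)"
proof (rule rms_le[OF Z(1,2)])
  fix y assume "y \<in> Z"
  then have y: "r2 \<le> norm y" using Z(3) by (auto simp: not_less)
  show "\<bar>err x xr k U i y\<bar> \<le> (c + 1) * rms (err x xr k U i) Y
      + (c + 2) * (1 + k * row_maxnorm U k i) / (r2 - r1) * (r1 / r2) ^ (c + 1)"
    by (rule abs_err_le_rms[OF r Y _ _ y]) (use x in auto)
qed

theorem theorem1:
  fixes r1 r2 :: real and n k c :: nat
    and x xr :: "nat \<Rightarrow> real^3" and U :: "nat \<Rightarrow> nat \<Rightarrow> real"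
    and Yp Y0 :: "(real^3) set"
  assumes r: "0 < r1" "r1 < r2"
    and X0: "inj_on x {..<n}" "\<forall>i<n. x i \<in> ball 0 r1"
    and Xrep: "inj_on xr {..<k}" "xr ` {..<k} \<subseteq> x ` {..<n}"
    and Yp: "finite Yp" "Yp \<noteq> {}" "Yp \<subseteq> sphere 0 r2"
    and quad: "\<forall>p. poly3_deg_le (2*c) p \<longrightarrow>
                 sphere_integral r2 p = 4 * pi * r2\<^sup>2 / card Yp * (\<Sum>y\<in>Yp. p y)"
    and Y0: "finite Y0" "Y0 \<noteq> {}" "Y0 \<subseteq> - ball 0 r2"
  shows "(\<forall>i<n. l2_on (err x xr k U i) Y0 / sqrt (card Y0)
            \<le> (c+1) * (l2_on (err x xr k U i) Yp / sqrt (card Yp))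
               + (c+2) * (1 + k * row_maxnorm U k i) / (r2 - r1) * (r1 / r2) ^ (c+1))
      \<and> (\<forall>\<epsilon>::real>0. (\<forall>i<n. l2_on (err x xr k U i) Yp \<le> \<epsilon> * sqrt (card Yp)) \<longrightarrow>
           (\<forall>i<n. l2_on (err x xr k U i) Y0 / sqrt (card Y0)
              \<le> (c+1) * \<epsilon>
                 + (c+2) * (1 + k * row_maxnorm U k i) / (r2 - r1) * (r1 / r2) ^ (c+1)))"
proof -
  let ?tail = "\<lambda>i. (c+2) * (1 + k * row_maxnorm U k i) / (r2 - r1) * (r1 / r2) ^ (c+1)"
  have design: "spherical_design r2 (2*c) Yp"
    using Yp quad by (simp add: spherical_design_def)
  have x: "norm (x i) \<le> r1" if "i < n" for i
    using X0(2) that by (simp add: less_imp_le)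
  then have xr: "norm (xr j) \<le> r1" if "j < k" for j
    using Xrep(2) that by (metis imageE image_subset_iff lessThan_iff)
  have bound: "rms (err x xr k U i) Y0 \<le> (c+1) * rms (err x xr k U i) Yp + ?tail i" if "i < n" for i
    by (rule rms_err_le[OF r design _ _ Y0]) (use x xr that in auto)
  have "rms (err x xr k U i) Y0 \<le> (c+1) * \<epsilon> + ?tail i"
    if "\<forall>i<n. l2_on (err x xr k U i) Yp \<le> \<epsilon> * sqrt (card Yp)" "i < n" for i and \<epsilon> :: real
  proof -
    have "rms (err x xr k U i) Yp \<le> \<epsilon>"
      using that Yp by (simp add: divide_le_eq card_gt_0_iff flip: l2_on_div_sqrt_card)
    then have "(c+1) * rms (err x xr k U i) Yp \<le> (c+1) * \<epsilon>" by (rule mult_left_mono) simp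
    then show ?thesis using bound[OF that(2)] by linarith
  qed
  with bound show ?thesis unfolding l2_on_div_sqrt_card by blast
qed

end
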